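(* Let $\ell$ be a positive integer and $Z(q)=\vartheta_3^4(q)$. Then $$-D_\ell^\perp(q)=\sqrt{\frac{Z(q)Z(q^\ell)}{A(q)A(q^\ell)}}\left(\frac{1}{1+\alpha(q)}\sqrt{\frac{Z(q)}{Z(q^\ell)}}\,\alpha(q)(1-\alpha(q))-\frac{\ell}{1+\alpha(q^\ell)}\sqrt{\frac{Z(q^\ell)}{Z(q)}}\,\alpha(q^\ell)(1-\alpha(q^\ell))-4D_\ell(q)\right),$$ where square roots are the branches positive for $0<q<1$.
   Context: For $0<|q|<1$ let $\vartheta_2(q)=\sum_{k\in\mathbb Z}q^{(k+1/2)^2}$, $\vartheta_3(q)=\sum_{k\in\mathbb Z}q^{k^2}$, $\alpha(q)=\vartheta_2^4(q)/\vartheta_3^4(q)$, and $$D_\ell(q)=\frac{1}{\vartheta_3^3(q)\vartheta_3^3(q^\ell)}\det\begin{pmatrix}\vartheta_3(q)&\vartheta_3(q^\ell)\\ q\frac{d\vartheta_3(q)}{dq}& q\frac{d\vartheta_3(q^\ell)}{dq}\end{pmatrix}.$$ $\eta(\tau)=e^{\pi i\tau/12}\prod_{k\ge1}(1-e^{2\pi ik\tau})$ is the Dedekind eta function; with $q=e^{\pi i\tau}$ define $A$ by $A(q^2)=\frac{\eta^8(\tau)+32\eta^8(4\tau)}{\eta^4(2\tau)}$, and $$D_\ell^\perp(q)=\frac{1}{\sqrt{A^3(q)A^3(q^\ell)}}\det\begin{pmatrix}A(q)&A(q^\ell)\\ q\frac{dA(q)}{dq}&q\frac{dA(q^\ell)}{dq}\end{pmatrix}.$$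 *)

theory Defs
  imports "HOL-Complex_Analysis.Complex_Analysis"
begin

text \<open>
  The power \<open>powr\<close> below is the principal one. As \<open>(k + 1/2)\<^sup>2 = k\<^sup>2 + k + 1/4\<close>, another choice of
  the logarithm of \<open>q\<close> multiplies \<open>theta2 q\<close> by a fourth root of unity; only \<open>theta2 q ^ 4\<close> is used.
\<close>

definition theta2 :: "complex \<Rightarrow> complex" where
  "theta2 q = (\<Sum>\<^sub>\<infinity>k\<in>(UNIV :: int set). q powr ((of_int k + 1/2)\<^sup>2))"

definition theta3 :: "complex \<Rightarrow> complex" where
  "theta3 q = (\<Sum>\<^sub>\<infinity>k\<in>(UNIV :: int set). q powi (k\<^sup>2))"

definition alpha :: "complex \<Rightarrow> complex" where
  "alpha q = theta2 q ^ 4 / theta3 q ^ 4"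

definition Z :: "complex \<Rightarrow> complex" where
  "Z q = theta3 q ^ 4"

definition D :: "nat \<Rightarrow> complex \<Rightarrow> complex" where
  "D l q = 1 / (theta3 q ^ 3 * theta3 (q ^ l) ^ 3) *
     det (vector [vector [theta3 q, theta3 (q ^ l)],
                  vector [q * deriv theta3 q, q * deriv (\<lambda>z. theta3 (z ^ l)) q]] :: complex^2^2)"

definition dedekind_eta :: "complex \<Rightarrow> complex" where
  "dedekind_eta \<tau> = exp (of_real pi * \<i> * \<tau> / 12) *
     (\<Prod>k. 1 - exp (2 * of_real pi * \<i> * of_nat (Suc k) * \<tau>))"

definition A_eta :: "complex \<Rightarrow> complex" where
  "A_eta \<tau> = (dedekind_eta \<tau> ^ 8 + 32 * dedekind_eta (4 * \<tau>) ^ 8) / dedekind_eta (2 * \<tau>) ^ 4"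

text \<open>
  \<open>A\<close> is determined by \<open>A (q\<^sup>2) = A_eta \<tau>\<close> for \<open>q = exp (\<pi>\<i>\<tau>)\<close>. The definition uses the \<open>\<tau>\<close> given by
  the principal logarithm; lemma \<open>A_exp\<close> shows that any other choice gives the same value.
\<close>

definition A :: "complex \<Rightarrow> complex" where
  "A q = A_eta (Ln q / (2 * of_real pi * \<i>))"

lemma dedekind_eta_add_int:
  "dedekind_eta (\<tau> + of_int n) = exp (of_real pi * \<i> * of_int n / 12) * dedekind_eta \<tau>"
proof -
  have *: "exp (2 * of_real pi * \<i> * of_nat (Suc k) * (\<tau> + of_int n)) =
        exp (2 * of_real pi * \<i> * of_nat (Suc k) * \<tau>)" for k
    unfolding exp_eq by (rule exI[of _ "int (Suc k) * n"]) (simp add: algebra_simps)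
  have "exp (of_real pi * \<i> * (\<tau> + of_int n) / 12) =
        exp (of_real pi * \<i> * of_int n / 12) * exp (of_real pi * \<i> * \<tau> / 12)"
    by (simp flip: exp_add add: algebra_simps add_divide_distrib)
  with * show ?thesis
    unfolding dedekind_eta_def by (simp only: mult.assoc)
qed

lemma A_eta_add_int: "A_eta (\<tau> + of_int n) = A_eta \<tau>"
proof -
  define w where "w = exp (of_real pi * \<i> * of_int n / 12)"
  have 1: "dedekind_eta (\<tau> + of_int n) = w * dedekind_eta \<tau>"
    unfolding w_def by (rule dedekind_eta_add_int)
  have 2: "dedekind_eta (2 * (\<tau> + of_int n)) = w ^ 2 * dedekind_eta (2 * \<tau>)"
    using dedekind_eta_add_int[of "2 * \<tau>" "2 * n"]
    unfolding w_def exp_of_nat_mult[symmetric] by (simp add: algebra_simps)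
  have 4: "dedekind_eta (4 * (\<tau> + of_int n)) = w ^ 4 * dedekind_eta (4 * \<tau>)"
    using dedekind_eta_add_int[of "4 * \<tau>" "4 * n"]
    unfolding w_def exp_of_nat_mult[symmetric] by (simp add: algebra_simps)
  have "w ^ 24 = exp (2 * of_int n * of_real pi * \<i>)"
    unfolding w_def exp_of_nat_mult[symmetric] by (simp add: algebra_simps)
  also have "\<dots> = 1"
    unfolding exp_eq_1 by (auto intro: exI[of _ n])
  finally have "w ^ 32 = w ^ 8"
    using power_add[of w 24 8] by simp
  hence "A_eta (\<tau> + of_int n) = (w ^ 8 * (dedekind_eta \<tau> ^ 8 + 32 * dedekind_eta (4 * \<tau>) ^ 8)) /
           (w ^ 8 * dedekind_eta (2 * \<tau>) ^ 4)"
    unfolding A_eta_def 1 2 4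
    by (simp add: power_mult_distrib algebra_simps flip: power_mult)
  also have "\<dots> = A_eta \<tau>"
    unfolding A_eta_def by (simp add: w_def)
  finally show ?thesis .
qed

lemma A_exp: "A ((exp (of_real pi * \<i> * \<tau>))\<^sup>2) = A_eta \<tau>"
proof -
  define q where "q = (exp (of_real pi * \<i> * \<tau>))\<^sup>2"
  have "q \<noteq> 0" by (simp add: q_def)
  hence "exp (Ln q) = exp (2 * of_real pi * \<i> * \<tau>)"
    unfolding q_def by (simp add: power2_eq_square algebra_simps flip: exp_add)
  then obtain n :: int where "Ln q = 2 * of_real pi * \<i> * \<tau> + of_int (2 * n) * of_real pi * \<i>"
    unfolding exp_eq by auto
  hence "Ln q / (2 * of_real pi * \<i>) = \<tau> + of_int n"
    by (simp add: field_simps)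
  thus ?thesis
    by (simp add: A_def A_eta_add_int flip: q_def)
qed

definition sqrt_branch_on :: "complex set \<Rightarrow> (complex \<Rightarrow> complex) \<Rightarrow> (complex \<Rightarrow> complex) \<Rightarrow> bool" where
  "sqrt_branch_on U f s \<longleftrightarrow>
     continuous_on U s \<and> (\<forall>q\<in>U. (s q)\<^sup>2 = f q) \<and>
     (\<forall>x::real. 0 < x \<and> x < 1 \<longrightarrow> Im (s (of_real x)) = 0 \<and> Re (s (of_real x)) > 0)"

text \<open>
  \<open>A\<close> has zeros in the punctured disc, so the square root in the denominator of \<open>D_perp\<close> has no
  single-valued branch there. The branch \<open>s\<close> of \<open>q \<mapsto> sqrt (A q ^ 3 * A (q ^ l) ^ 3)\<close> is a parameter.
\<close>

definition D_perp :: "(complex \<Rightarrow> complex) \<Rightarrow> nat \<Rightarrow> complex \<Rightarrow> complex" where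
  "D_perp s l q = 1 / s q *
     det (vector [vector [A q, A (q ^ l)],
                  vector [q * deriv A q, q * deriv (\<lambda>z. A (z ^ l)) q]] :: complex^2^2)"

end

theory Submission
  imports Defs
begin

text \<open>
  Write \<open>psi q\<close> for the sum of \<open>q ^ (k\<^sup>2 + k)\<close> over all integers \<open>k\<close>, so that \<open>theta2 q ^ 4 = q * psi q ^ 4\<close>.
  Splitting lattice sums by the parity of \<open>m + n\<close> gives the duplication formulas for \<open>theta3 q ^ 2\<close> and
  \<open>psi q ^ 2\<close> in terms of \<open>theta3 (q\<^sup>2)\<close> and \<open>psi (q\<^sup>2)\<close>. They imply Jacobi's quartic identity and, by
  iterating \<open>q \<mapsto> q\<^sup>2\<close> towards 0, that \<open>theta3\<close> and \<open>psi\<close> have no zeros in the disc. The same iteration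
  proves \<open>q \<alpha>' = Z \<alpha> (1 - \<alpha>)\<close>. Jacobi's triple product, obtained as a limit of its finite form, turns
  the eta quotient into \<open>A = Z (1 + \<alpha>)\<close>. Hence \<open>q A' / A = 4 q theta3' / theta3 + Z \<alpha> (1 - \<alpha>) / (1 + \<alpha>)\<close>,
  and the theorem is the difference of this formula at \<open>q\<close> and at \<open>q ^ l\<close>. On the connected set \<open>U\<close> the
  branches of the square roots are determined by their sign at one real point.
\<close>

subsection \<open>Theta series and duplication formulas\<close>

text \<open>Natural exponents make every term a monomial in \<open>q\<close>, so the series also has
  a value at \<open>q = 0\<close> (with \<open>0 ^ 0 = 1\<close>), the point to which iterated
  squaring leads.\<close>

definition exponent_series :: "(int \<Rightarrow> nat) \<Rightarrow> complex \<Rightarrow> complex" where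
  "exponent_series e q = (\<Sum>\<^sub>\<infinity>k\<in>UNIV. q ^ e k)"

text \<open>This is twice Ramanujan's psi function at q^2, that is, theta2 freed from its
  multivalued factor q^(1/4).\<close>

definition psi :: "complex \<Rightarrow> complex" where
  "psi = exponent_series (\<lambda>k. nat (k\<^sup>2 + k))"

lemma theta3_eq_exponent_series: "theta3 = exponent_series (\<lambda>k. nat (k\<^sup>2))"
  by (intro ext) (simp add: theta3_def exponent_series_def power_int_def)

section \<open>Absolute convergence and holomorphy of the series\<close>

lemma summable_on_power_nat_abs:
  fixes r :: real
  assumes "0 \<le> r" "r < 1"
  shows "(\<lambda>k::int. r ^ nat \<bar>k\<bar>) summable_on UNIV"
proof -
  have nat: "(\<lambda>n. r ^ n) summable_on (UNIV :: nat set)"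
    using assms by (intro norm_summable_imp_summable_on) (simp add: summable_geometric)
  have "(\<lambda>k::int. r ^ nat \<bar>k\<bar>) summable_on range int"
    using nat by (subst summable_on_reindex) (auto simp: o_def)
  moreover have "(\<lambda>k::int. r ^ nat \<bar>k\<bar>) summable_on range (\<lambda>n. - int n)"
    using nat by (subst summable_on_reindex) (auto simp: o_def inj_on_def)
  ultimately have "(\<lambda>k::int. r ^ nat \<bar>k\<bar>) summable_on (range int \<union> range (\<lambda>n. - int n))"
    by (rule summable_on_union)
  also have "range int \<union> range (\<lambda>n. - int n) = UNIV"
    by (metis (no_types, lifting) UNIV_eq_I UnI1 UnI2 int_cases2 rangeI)
  finally show ?thesis .
qed

text \<open>Linear growth of the exponents gives comparison with a geometric series. The slack 1
  accounts for k = -1, where the pronic and the shifted square exponents vanish.\<close>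

definition admissible :: "(int \<Rightarrow> nat) \<Rightarrow> bool" where
  "admissible e \<longleftrightarrow> (\<forall>k. \<bar>k\<bar> \<le> int (e k) + 1)"

lemma admissible_square: "admissible (\<lambda>k. nat (k\<^sup>2))"
  and admissible_square_shift: "admissible (\<lambda>k. nat ((k + 1)\<^sup>2))"
  and admissible_pronic: "admissible (\<lambda>k. nat (k\<^sup>2 + k))"
proof -
  have sq: "\<bar>k\<bar> \<le> k\<^sup>2" for k :: int
    using self_le_power[of "\<bar>k\<bar>" 2] by (cases "k = 0") auto
  show "admissible (\<lambda>k. nat (k\<^sup>2))"
    using sq by (auto simp: admissible_def intro: order_trans[OF sq])
  show "admissible (\<lambda>k. nat ((k + 1)\<^sup>2))"
  proof (unfold admissible_def, intro allI)
    fix k :: int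
    show "\<bar>k\<bar> \<le> int (nat ((k + 1)\<^sup>2)) + 1"
      using sq[of "k + 1"] by (auto simp: abs_if split: if_splits)
  qed
  show "admissible (\<lambda>k. nat (k\<^sup>2 + k))"
  proof (unfold admissible_def, intro allI)
    fix k :: int
    have "\<bar>k\<bar> \<le> k\<^sup>2 + k + 1"
    proof (cases "k \<ge> 0")
      case True
      thus ?thesis using zero_le_power2[of k] by linarith
    next
      case False
      have "(k + 1)\<^sup>2 = k\<^sup>2 + 2 * k + 1"
        by (simp add: power2_eq_square algebra_simps)
      thus ?thesis using False zero_le_power2[of "k + 1"] by linarith
    qed
    thus "\<bar>k\<bar> \<le> int (nat (k\<^sup>2 + k)) + 1" by linarith
  qed
qed

text \<open>The factor \<open>inverse r\<close> pays for the slack 1 in \<open>admissible\<close>.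
  The bound depends on \<open>q\<close> only through \<open>r\<close>, so it serves the M-test on
  \<open>cball 0 r\<close> as well as absolute convergence.\<close>

lemma power_le_of_admissible:
  fixes q :: complex
  assumes "admissible e" "norm q \<le> r" "0 < r" "r < 1"
  shows "norm (q ^ e k) \<le> inverse r * r ^ nat \<bar>k\<bar>"
proof -
  have "norm (q ^ e k) \<le> r ^ e k"
    using assms by (simp add: norm_power power_mono)
  also have "\<dots> = inverse r * r ^ (e k + 1)"
    using assms by (simp add: field_simps)
  also have "r ^ (e k + 1) \<le> r ^ nat \<bar>k\<bar>"
    using assms by (intro power_decreasing) (auto simp: admissible_def dest!: spec[of _ k])
  finally show ?thesis using assms by (simp add: mult_left_mono)
qed

lemma exponent_series_abs_summable:
  fixes q :: complex
  assumes "admissible e" "norm q < 1"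
  shows "(\<lambda>k. norm (q ^ e k)) summable_on UNIV"
proof -
  obtain r where r: "norm q < r" "r < 1"
    using assms(2) dense by blast
  have "0 < r" using r norm_ge_zero[of q] by linarith
  show ?thesis
  proof (rule Infinite_Sum.abs_summable_on_comparison_test')
    show "(\<lambda>k::int. inverse r * r ^ nat \<bar>k\<bar>) summable_on UNIV"
      using r \<open>0 < r\<close> by (intro summable_on_cmult_right summable_on_power_nat_abs) auto
    show "norm (q ^ e k) \<le> inverse r * r ^ nat \<bar>k\<bar>" for k
      using power_le_of_admissible[of e q r k] assms r \<open>0 < r\<close> by simp
  qed
qed

lemma has_sum_exponent_series:
  assumes "admissible e" "norm q < 1"
  shows "((\<lambda>k. q ^ e k) has_sum exponent_series e q) UNIV"
  unfolding exponent_series_def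
  by (rule has_sum_infsum[OF Infinite_Sum.abs_summable_summable[OF exponent_series_abs_summable[OF assms]]])

text \<open>By the M-test the finite partial sums converge uniformly on each
  \<open>cball 0 r\<close> with \<open>r < 1\<close>, and these discs exhaust the unit disc.\<close>

lemma holomorphic_exponent_series:
  assumes "admissible e"
  shows "exponent_series e holomorphic_on ball 0 1"
proof -
  have "\<exists>d>0. exponent_series e holomorphic_on ball z d" if "z \<in> ball 0 1" for z
  proof -
    have "norm z < 1" using that by simp
    then obtain r where r: "norm z < r" "r < 1"
      using dense by blast
    have "0 < r" using r norm_ge_zero[of z] by linarith
    have ulim: "uniform_limit (cball 0 r) (\<lambda>X q. \<Sum>k\<in>X. (q::complex) ^ e k)
        (\<lambda>q. \<Sum>\<^sub>\<infinity>k\<in>UNIV. q ^ e k) (finite_subsets_at_top UNIV)"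
    proof (rule Weierstrass_m_test_general)
      show "(\<lambda>k::int. inverse r * r ^ nat \<bar>k\<bar>) summable_on UNIV"
        using r \<open>0 < r\<close> by (intro summable_on_cmult_right summable_on_power_nat_abs) auto
      show "norm (q ^ e k) \<le> inverse r * r ^ nat \<bar>k\<bar>" if "q \<in> cball 0 r" for k and q :: complex
        using power_le_of_admissible[of e q r k] assms r \<open>0 < r\<close> that by simp
    qed
    have ev: "\<forall>\<^sub>F X in finite_subsets_at_top UNIV.
        continuous_on (cball 0 r) (\<lambda>q. \<Sum>k\<in>X. (q::complex) ^ e k) \<and>
        (\<lambda>q. \<Sum>k\<in>X. q ^ e k) holomorphic_on ball 0 r"
      by (intro always_eventually allI conjI continuous_intros holomorphic_intros)
    have "(\<lambda>q. \<Sum>\<^sub>\<infinity>k\<in>UNIV. q ^ e k) holomorphic_on ball 0 r"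
      by (rule holomorphic_uniform_limit[OF ev ulim finite_subsets_at_top_neq_bot])
    hence "exponent_series e holomorphic_on ball 0 r"
      by (simp add: exponent_series_def[abs_def])
    moreover have "ball z (r - norm z) \<subseteq> ball 0 r"
      by (simp add: ball_subset_ball_iff)
    ultimately show ?thesis
      using r by (intro exI[of _ "r - norm z"]) (auto intro: holomorphic_on_subset)
  qed
  hence "exponent_series e analytic_on ball 0 1"
    unfolding analytic_on_def by blast
  thus ?thesis
    by (rule analytic_imp_holomorphic)
qed

section \<open>Products of two series as sums over pairs of integers\<close>

lemma has_sum_exponent_series_mult:
  assumes "admissible e" "admissible f" "norm q < 1"
  shows "((\<lambda>(m, n). q ^ (e m + f n)) has_sum exponent_series e q * exponent_series f q) UNIV"
proof -
  have "((\<lambda>(m, n). q ^ e m * q ^ f n) has_sum exponent_series e q * exponent_series f q)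
          (UNIV \<times> UNIV)"
  proof (rule has_sum_SigmaI)
    show "((\<lambda>n. case (m, n) of (m, n) \<Rightarrow> q ^ e m * q ^ f n) has_sum q ^ e m * exponent_series f q) UNIV"
      for m using has_sum_cmult_right[OF has_sum_exponent_series[OF assms(2,3)]] by simp
    show "((\<lambda>m. q ^ e m * exponent_series f q) has_sum exponent_series e q * exponent_series f q) UNIV"
      by (intro has_sum_cmult_left has_sum_exponent_series assms)
    have "(\<lambda>x. norm (case x of (m, n) \<Rightarrow> q ^ e m * q ^ f n)) summable_on UNIV \<times> UNIV"
      unfolding Infinite_Sum.abs_summable_on_Sigma_iff prod.case norm_mult infsum_cmult_right'
        real_norm_def abs_mult abs_norm_cancel
      using exponent_series_abs_summable[OF assms(1,3)] exponent_series_abs_summable[OF assms(2,3)]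
      by (intro conjI ballI summable_on_cmult_right summable_on_cmult_left)
    thus "(\<lambda>(m, n). q ^ e m * q ^ f n) summable_on UNIV \<times> UNIV"
      by (rule Infinite_Sum.abs_summable_summable)
  qed
  thus ?thesis by (simp add: power_add)
qed

text \<open>The pairs (m, n) with m + n even are the (a + b, a - b), those with m + n odd the (a + b
  + 1, a - b), and each pair arises exactly once.\<close>

lemma has_sum_int_pairs_by_parity:
  fixes f :: "int \<times> int \<Rightarrow> 'a :: topological_comm_monoid_add"
  assumes "((\<lambda>(a, b). f (a + b, a - b)) has_sum S) UNIV"
    and "((\<lambda>(a, b). f (a + b + 1, a - b)) has_sum T) UNIV"
  shows "(f has_sum (S + T)) UNIV"
proof -
  let ?g = "\<lambda>(a, b). (a + b, a - b) :: int \<times> int"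
  let ?h = "\<lambda>(a, b). (a + b + 1, a - b) :: int \<times> int"
  have "(f has_sum S) (range ?g)"
    using assms(1) by (subst has_sum_reindex) (auto simp: inj_on_def o_def case_prod_unfold)
  moreover have "(f has_sum T) (range ?h)"
    using assms(2) by (subst has_sum_reindex) (auto simp: inj_on_def o_def case_prod_unfold)
  moreover have "range ?g \<inter> range ?h = {}"
  proof -
    have False if "a + b = c + d + 1" "a - b = c - d" for a b c d :: int
    proof -
      have "2 * a = 2 * c + 1" using that by linarith
      thus False by presburger
    qed
    thus ?thesis by auto
  qed
  ultimately have "(f has_sum (S + T)) (range ?g \<union> range ?h)"
    by (rule has_sum_Un_disjoint)
  also have "range ?g \<union> range ?h = UNIV"
  proof (intro equalityI subsetI UNIV_I)
    fix x :: "int \<times> int"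
    obtain m n where x: "x = (m, n)" by force
    show "x \<in> range ?g \<union> range ?h"
    proof (cases "even (m + n)")
      case True
      then obtain a where "m + n = 2 * a" by (elim evenE)
      hence "x = ?g (a, a - n)"
        unfolding x by simp
      thus ?thesis by blast
    next
      case False
      then obtain a where "m + n = 2 * a + 1" by (elim oddE)
      hence "x = ?h (a, a - n)"
        unfolding x by simp
      thus ?thesis by blast
    qed
  qed
  finally show ?thesis .
qed

lemma pronic_nonneg: "0 \<le> k\<^sup>2 + (k::int)"
  using zero_le_power2[of "2 * k + 1"] by (simp add: power2_eq_square algebra_simps)

text \<open>On the even class m^2 + n^2 becomes 2(a^2 + b^2), which gives the first term. On the odd
  class it becomes 1 + 2((a^2 + a) + (b^2 + b)), which gives the second.\<close>

lemma theta3_square: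
  assumes "norm q < 1"
  shows "theta3 q ^ 2 = theta3 (q\<^sup>2) ^ 2 + q * psi (q\<^sup>2) ^ 2"
proof -
  have q2: "norm (q\<^sup>2) < 1"
    using assms by (simp add: norm_power power_less_one_iff)
  let ?f = "\<lambda>(m, n). q ^ (nat (m\<^sup>2) + nat (n\<^sup>2))"
  have e1: "nat ((a + b)\<^sup>2) + nat ((a - b)\<^sup>2) = 2 * (nat (a\<^sup>2) + nat (b\<^sup>2))" for a b :: int
  proof -
    have "(a + b)\<^sup>2 + (a - b)\<^sup>2 = 2 * (a\<^sup>2 + b\<^sup>2)"
      by (simp add: power2_eq_square algebra_simps)
    thus ?thesis by (simp flip: nat_add_distrib add: nat_mult_distrib)
  qed
  have e2: "nat ((a + b + 1)\<^sup>2) + nat ((a - b)\<^sup>2) = Suc (2 * (nat (a\<^sup>2 + a) + nat (b\<^sup>2 + b)))"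
    for a b :: int
  proof -
    have "(a + b + 1)\<^sup>2 + (a - b)\<^sup>2 = 1 + 2 * ((a\<^sup>2 + a) + (b\<^sup>2 + b))"
      by (simp add: power2_eq_square algebra_simps)
    hence "int (nat ((a + b + 1)\<^sup>2) + nat ((a - b)\<^sup>2)) =
           int (Suc (2 * (nat (a\<^sup>2 + a) + nat (b\<^sup>2 + b))))"
      using pronic_nonneg[of a] pronic_nonneg[of b] by simp
    thus ?thesis by (simp only: of_nat_eq_iff)
  qed
  have "(?f has_sum (theta3 (q\<^sup>2) * theta3 (q\<^sup>2) + q * (psi (q\<^sup>2) * psi (q\<^sup>2)))) UNIV"
  proof (rule has_sum_int_pairs_by_parity)
    show "((\<lambda>(a, b). ?f (a + b, a - b)) has_sum theta3 (q\<^sup>2) * theta3 (q\<^sup>2)) UNIV"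
      using has_sum_exponent_series_mult[OF admissible_square admissible_square q2]
      by (simp only: theta3_eq_exponent_series e1 power_mult case_prod_unfold fst_conv snd_conv)
    show "((\<lambda>(a, b). ?f (a + b + 1, a - b)) has_sum q * (psi (q\<^sup>2) * psi (q\<^sup>2))) UNIV"
      using has_sum_cmult_right[OF has_sum_exponent_series_mult[OF admissible_pronic admissible_pronic q2], of q]
      by (simp only: psi_def e2 power_Suc power_mult case_prod_unfold fst_conv snd_conv)
  qed
  moreover have "(?f has_sum theta3 q * theta3 q) UNIV"
    unfolding theta3_eq_exponent_series
    by (intro has_sum_exponent_series_mult admissible_square assms)
  ultimately show ?thesis
    unfolding power2_eq_square using has_sum_unique by blast
qed

text \<open>The odd class in the duplication formula for \<open>psi\<close> produces the exponent (a
  + 1)^2.\<close>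

lemma exponent_series_square_shift:
  "exponent_series (\<lambda>k. nat ((k + 1)\<^sup>2)) = theta3"
proof
  fix q :: complex
  have "bij_betw (\<lambda>k::int. k + 1) UNIV UNIV"
    by (rule bij_betwI[of _ _ _ "\<lambda>k. k - 1"]) auto
  from infsum_reindex_bij_betw[OF this, of "\<lambda>k. q ^ nat (k\<^sup>2)"]
  show "exponent_series (\<lambda>k. nat ((k + 1)\<^sup>2)) q = theta3 q"
    by (simp add: exponent_series_def theta3_eq_exponent_series)
qed

text \<open>The exponent is 2((a^2 + a) + b^2) on the even class and 2((a + 1)^2 + (b^2 + b)) on the
  odd one. Both classes contribute the same sum, hence the factor 2.\<close>

lemma psi_square:
  assumes "norm q < 1"
  shows "psi q ^ 2 = 2 * psi (q\<^sup>2) * theta3 (q\<^sup>2)"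
proof -
  have q2: "norm (q\<^sup>2) < 1"
    using assms by (simp add: norm_power power_less_one_iff)
  let ?f = "\<lambda>(m, n). q ^ (nat (m\<^sup>2 + m) + nat (n\<^sup>2 + n))"
  have e1: "nat ((a + b)\<^sup>2 + (a + b)) + nat ((a - b)\<^sup>2 + (a - b)) =
            2 * (nat (a\<^sup>2 + a) + nat (b\<^sup>2))" for a b :: int
  proof -
    have "((a + b)\<^sup>2 + (a + b)) + ((a - b)\<^sup>2 + (a - b)) = 2 * ((a\<^sup>2 + a) + b\<^sup>2)"
      by (simp add: power2_eq_square algebra_simps)
    hence "int (nat ((a + b)\<^sup>2 + (a + b)) + nat ((a - b)\<^sup>2 + (a - b))) =
            int (2 * (nat (a\<^sup>2 + a) + nat (b\<^sup>2)))"
      using pronic_nonneg[of a] pronic_nonneg[of "a + b"] pronic_nonneg[of "a - b"] by simp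
    thus ?thesis by (simp only: of_nat_eq_iff)
  qed
  have e2: "nat ((a + b + 1)\<^sup>2 + (a + b + 1)) + nat ((a - b)\<^sup>2 + (a - b)) =
            2 * (nat ((a + 1)\<^sup>2) + nat (b\<^sup>2 + b))" for a b :: int
  proof -
    have "((a + b + 1)\<^sup>2 + (a + b + 1)) + ((a - b)\<^sup>2 + (a - b)) = 2 * ((a + 1)\<^sup>2 + (b\<^sup>2 + b))"
      by (simp add: power2_eq_square algebra_simps)
    hence "int (nat ((a + b + 1)\<^sup>2 + (a + b + 1)) + nat ((a - b)\<^sup>2 + (a - b))) =
            int (2 * (nat ((a + 1)\<^sup>2) + nat (b\<^sup>2 + b)))"
      using pronic_nonneg[of b] pronic_nonneg[of "a + b + 1"] pronic_nonneg[of "a - b"] by simp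
    thus ?thesis by (simp only: of_nat_eq_iff)
  qed
  have "(?f has_sum (psi (q\<^sup>2) * theta3 (q\<^sup>2) + theta3 (q\<^sup>2) * psi (q\<^sup>2))) UNIV"
  proof (rule has_sum_int_pairs_by_parity)
    show "((\<lambda>(a, b). ?f (a + b, a - b)) has_sum psi (q\<^sup>2) * theta3 (q\<^sup>2)) UNIV"
      using has_sum_exponent_series_mult[OF admissible_pronic admissible_square q2]
      by (simp only: theta3_eq_exponent_series psi_def e1 power_mult case_prod_unfold fst_conv snd_conv)
    show "((\<lambda>(a, b). ?f (a + b + 1, a - b)) has_sum theta3 (q\<^sup>2) * psi (q\<^sup>2)) UNIV"
      using has_sum_exponent_series_mult[OF admissible_square_shift admissible_pronic q2]
      unfolding exponent_series_square_shift
      by (simp only: psi_def e2 power_Suc power_mult case_prod_unfold fst_conv snd_conv)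
  qed
  moreover have "(?f has_sum psi q * psi q) UNIV"
    unfolding psi_def
    by (intro has_sum_exponent_series_mult admissible_pronic assms)
  ultimately have "psi q * psi q = psi (q\<^sup>2) * theta3 (q\<^sup>2) + theta3 (q\<^sup>2) * psi (q\<^sup>2)"
    using has_sum_unique by blast
  thus ?thesis by (simp add: power2_eq_square)
qed

subsection \<open>Jacobi's quartic identity and the logarithmic derivative\<close>

lemma exponent_series_0:
  assumes "finite {k. e k = 0}"
  shows "exponent_series e 0 = of_nat (card {k. e k = 0})"
proof -
  have "((\<lambda>k. (0::complex) ^ e k) has_sum of_nat (card {k. e k = 0})) UNIV"
    by (rule has_sum_finite_neutralI[OF assms]) auto
  thus ?thesis
    unfolding exponent_series_def by (rule infsumI)
qed

lemma theta3_0 [simp]: "theta3 0 = 1"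
proof -
  have *: "{k::int. nat (k\<^sup>2) = 0} = {0}"
    by auto
  show ?thesis
    unfolding theta3_eq_exponent_series by (subst exponent_series_0) (simp_all only: *, auto)
qed

lemma psi_0 [simp]: "psi 0 = 2"
proof -
  have "k\<^sup>2 + k \<le> 0 \<longleftrightarrow> k = 0 \<or> k = -1" for k :: int
  proof -
    have "k\<^sup>2 + k \<le> 0 \<longleftrightarrow> k\<^sup>2 + k = 0"
      using pronic_nonneg[of k] by linarith
    also have "\<dots> \<longleftrightarrow> k * (k + 1) = 0"
      by (simp add: power2_eq_square algebra_simps)
    also have "\<dots> \<longleftrightarrow> k = 0 \<or> k = -1"
      by auto
    finally show ?thesis .
  qed
  hence *: "{k::int. nat (k\<^sup>2 + k) = 0} = {0, -1}"
    by auto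
  show ?thesis
    unfolding psi_def by (subst exponent_series_0) (simp_all only: *, auto)
qed

lemma holomorphic_theta3: "theta3 holomorphic_on ball 0 1"
  unfolding theta3_eq_exponent_series by (intro holomorphic_exponent_series admissible_square)

lemma holomorphic_psi: "psi holomorphic_on ball 0 1"
  unfolding psi_def by (intro holomorphic_exponent_series admissible_pronic)

lemma has_field_derivative_theta3:
  assumes "norm q < 1"
  shows "(theta3 has_field_derivative deriv theta3 q) (at q)"
  using holomorphic_derivI[OF holomorphic_theta3, of q] assms by simp

lemma has_field_derivative_psi:
  assumes "norm q < 1"
  shows "(psi has_field_derivative deriv psi q) (at q)"
  using holomorphic_derivI[OF holomorphic_psi, of q] assms by simp

lemma continuous_on_theta3: "continuous_on (ball 0 1) theta3"
  using holomorphic_theta3 by (rule holomorphic_on_imp_continuous_on)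

lemma continuous_on_psi: "continuous_on (ball 0 1) psi"
  using holomorphic_psi by (rule holomorphic_on_imp_continuous_on)

text \<open>Replacing \<open>q\<close> by \<open>- q\<close>, which turns theta3 into theta4, flips
  the sign of the last term in \<open>theta3_square\<close>. The difference of the squared formulas
  is then a multiple of the square of \<open>psi_square\<close>.\<close>

lemma jacobi_theta_quartic:
  assumes "norm q < 1"
  shows "theta3 q ^ 4 = theta3 (- q) ^ 4 + q * psi q ^ 4"
proof -
  have p: "theta3 q ^ 2 = theta3 (q\<^sup>2) ^ 2 + q * psi (q\<^sup>2) ^ 2"
    using theta3_square[OF assms] .
  have m: "theta3 (- q) ^ 2 = theta3 (q\<^sup>2) ^ 2 - q * psi (q\<^sup>2) ^ 2"
    using theta3_square[of "- q"] assms by simp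
  have s: "psi q ^ 2 = 2 * psi (q\<^sup>2) * theta3 (q\<^sup>2)"
    using psi_square[OF assms] .
  have "theta3 q ^ 4 - theta3 (- q) ^ 4 = (theta3 q ^ 2)\<^sup>2 - (theta3 (- q) ^ 2)\<^sup>2"
    by (simp flip: power_mult)
  also have "\<dots> = q * (psi q ^ 2)\<^sup>2"
    unfolding p m s by (simp add: power2_eq_square algebra_simps)
  also have "\<dots> = q * psi q ^ 4"
    by (simp flip: power_mult)
  finally show ?thesis by (simp add: algebra_simps)
qed

text \<open>The duplication formulas at \<open>q\<close> and \<open>- q\<close> multiply to a
  difference of squares, which the quartic identity at q^2 evaluates.\<close>

lemma theta3_square_mult_theta3_minus_square:
  assumes "norm q < 1"
  shows "theta3 q ^ 2 * theta3 (- q) ^ 2 = theta3 (- (q\<^sup>2)) ^ 4"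
proof -
  have q2: "norm (q\<^sup>2) < 1"
    using assms by (simp add: norm_power power_less_one_iff)
  have p: "theta3 q ^ 2 = theta3 (q\<^sup>2) ^ 2 + q * psi (q\<^sup>2) ^ 2"
    using theta3_square[OF assms] .
  have m: "theta3 (- q) ^ 2 = theta3 (q\<^sup>2) ^ 2 - q * psi (q\<^sup>2) ^ 2"
    using theta3_square[of "- q"] assms by simp
  have "theta3 q ^ 2 * theta3 (- q) ^ 2 = theta3 (q\<^sup>2) ^ 4 - q\<^sup>2 * psi (q\<^sup>2) ^ 4"
    unfolding p m by (simp add: algebra_simps power2_eq_square power4_eq_xxxx)
  also have "\<dots> = theta3 (- (q\<^sup>2)) ^ 4"
    using jacobi_theta_quartic[OF q2] by (simp add: algebra_simps)
  finally show ?thesis .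
qed

section \<open>Iterated squaring and absence of zeros\<close>

lemma tendsto_iterated_square:
  fixes f :: "complex \<Rightarrow> 'a :: topological_space"
  assumes cont: "continuous_on (ball 0 1) f" and q: "norm q < 1"
  shows "(\<lambda>n. f (q ^ (2 ^ n))) \<longlonglongrightarrow> f 0"
proof -
  have "filterlim (\<lambda>n. 2 ^ n :: nat) sequentially sequentially"
    by (rule filterlim_subseq) (auto intro!: strict_monoI power_strict_increasing)
  from filterlim_compose[OF LIMSEQ_power_zero[OF q] this]
  have "(\<lambda>n. q ^ (2 ^ n)) \<longlonglongrightarrow> 0" .
  moreover have "isCont f 0"
    using cont by (simp add: continuous_on_eq_continuous_at)
  ultimately show ?thesis
    using isCont_tendsto_compose by blast
qed

text \<open>The values at q^(2^n) form a constant sequence that converges to the value at 0.\<close>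

lemma eq_limit_at_0_of_invariant_square:
  fixes f :: "complex \<Rightarrow> 'a :: t2_space"
  assumes cont: "continuous_on (ball 0 1) f"
    and inv: "\<And>q. norm q < 1 \<Longrightarrow> f q = f (q\<^sup>2)"
    and q: "norm q < 1"
  shows "f q = f 0"
proof -
  have less: "norm (q ^ (2 ^ n)) < 1" for n :: nat
    using q by (simp add: norm_power power_less_one_iff)
  have "f (q ^ (2 ^ n)) = f q" for n
  proof (induction n)
    case (Suc n)
    have "f (q ^ (2 ^ Suc n)) = f ((q ^ (2 ^ n))\<^sup>2)"
      by (simp flip: power_mult add: mult.commute)
    also have "\<dots> = f q"
      using inv[OF less[of n]] Suc by simp
    finally show ?case .
  qed simp
  moreover have "(\<lambda>n. f (q ^ (2 ^ n))) \<longlonglongrightarrow> f 0"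
    by (rule tendsto_iterated_square[OF cont q])
  ultimately show ?thesis
    by (simp add: LIMSEQ_const_iff)
qed

text \<open>A zero would reproduce itself at every q^(2^n), and these points accumulate at 0, where
  continuity forbids it.\<close>

lemma nonzero_if_zeros_closed_under_square:
  fixes f :: "complex \<Rightarrow> complex"
  assumes cont: "continuous_on (ball 0 1) f" and "f 0 \<noteq> 0"
    and zeros: "\<And>q. norm q < 1 \<Longrightarrow> f q = 0 \<Longrightarrow> f (q\<^sup>2) = 0"
    and q: "norm q < 1"
  shows "f q \<noteq> 0"
proof
  assume "f q = 0"
  have less: "norm (q ^ (2 ^ n)) < 1" for n :: nat
    using q by (simp add: norm_power power_less_one_iff)
  have "f (q ^ (2 ^ n)) = 0" for n
  proof (induction n)
    case (Suc n)
    have "q ^ (2 ^ Suc n) = (q ^ (2 ^ n))\<^sup>2"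
      by (simp flip: power_mult add: mult.commute)
    thus ?case
      using zeros[OF less[of n]] Suc by simp
  qed (use \<open>f q = 0\<close> in simp)
  moreover have "(\<lambda>n. f (q ^ (2 ^ n))) \<longlonglongrightarrow> f 0"
    by (rule tendsto_iterated_square[OF cont q])
  ultimately show False
    using \<open>f 0 \<noteq> 0\<close> by (simp add: LIMSEQ_const_iff)
qed

lemma theta3_nonzero:
  assumes "norm q < 1"
  shows "theta3 q \<noteq> 0"
proof -
  \<comment> \<open>The product formula at a zero of theta3(-q) yields a zero of theta3(-q^2). So
    the iteration runs for the function theta3(-q), started at the point \<open>- q\<close>.\<close>
  have "theta3 (- (- q)) \<noteq> 0"
  proof (rule nonzero_if_zeros_closed_under_square[where f = "\<lambda>q. theta3 (- q)"])
    show "continuous_on (ball 0 1) (\<lambda>q. theta3 (- q))"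
      by (rule continuous_on_compose2[OF continuous_on_theta3]) (auto intro!: continuous_intros)
    show "theta3 (- (q\<^sup>2)) = 0" if "norm q < 1" "theta3 (- q) = 0" for q
      using theta3_square_mult_theta3_minus_square[OF that(1)] that(2) by simp
  qed (use assms in auto)
  thus ?thesis by simp
qed

text \<open>In the duplication formula the factor \<open>theta3\<close> at q^2 is nonzero, so a zero
  of \<open>psi\<close> passes from q to q^2.\<close>

lemma psi_nonzero:
  assumes "norm q < 1"
  shows "psi q \<noteq> 0"
proof (rule nonzero_if_zeros_closed_under_square[OF continuous_on_psi _ _ assms])
  show "psi (q\<^sup>2) = 0" if "norm q < 1" "psi q = 0" for q
  proof -
    have "norm (q\<^sup>2) < 1"
      using that by (simp add: norm_power power_less_one_iff)
    thus ?thesis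
      using psi_square[OF that(1)] that(2) theta3_nonzero by simp
  qed
qed simp

text \<open>
  The left-hand side is the logarithmic derivative of \<open>q * psi q ^ 4 / theta3 q ^ 4\<close>. By the duplication
  formulas, its quotient by \<open>theta3 (- q) ^ 4\<close> is invariant under \<open>q \<mapsto> q\<^sup>2\<close>.
\<close>

lemma logderiv_psi_theta3:
  assumes q: "norm q < 1"
  shows "1 + 4 * q * deriv psi q / psi q - 4 * q * deriv theta3 q / theta3 q = theta3 (- q) ^ 4"
proof -
  define E where "E = (\<lambda>q. 1 + 4 * q * deriv psi q / psi q - 4 * q * deriv theta3 q / theta3 q)"
  have minus: "continuous_on (ball 0 1) (\<lambda>q. theta3 (- q))"
    by (rule continuous_on_compose2[OF continuous_on_theta3]) (auto intro!: continuous_intros)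
  have "E q / theta3 (- q) ^ 4 = E 0 / theta3 (- 0) ^ 4"
  proof (rule eq_limit_at_0_of_invariant_square[where f = "\<lambda>q. E q / theta3 (- q) ^ 4", OF _ _ q])
    have "continuous_on (ball 0 1) (deriv theta3)" "continuous_on (ball 0 1) (deriv psi)"
      by (auto intro!: holomorphic_on_imp_continuous_on holomorphic_deriv
          holomorphic_theta3 holomorphic_psi)
    thus "continuous_on (ball 0 1) (\<lambda>q. E q / theta3 (- q) ^ 4)"
      unfolding E_def
      by (intro continuous_intros minus continuous_on_theta3 continuous_on_psi)
         (auto simp: theta3_nonzero psi_nonzero)
  next
    fix q :: complex
    assume q: "norm q < 1"
    have q2: "norm (q\<^sup>2) < 1"
      using q by (simp add: norm_power power_less_one_iff)
    define X Y x y where "X = theta3 (q\<^sup>2)" and "Y = psi (q\<^sup>2)"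
      and "x = deriv theta3 (q\<^sup>2)" and "y = deriv psi (q\<^sup>2)"
    have nz: "X \<noteq> 0" "Y \<noteq> 0" "theta3 q \<noteq> 0" "psi q \<noteq> 0" "theta3 (- q) \<noteq> 0"
      using q q2 by (simp_all add: X_def Y_def theta3_nonzero psi_nonzero)
    have th: "theta3 q ^ 2 = X\<^sup>2 + q * Y\<^sup>2" and th4: "theta3 (- q) ^ 2 = X\<^sup>2 - q * Y\<^sup>2"
      using theta3_square[OF q] theta3_square[of "- q"] q by (simp_all add: X_def Y_def)
    have ps: "psi q ^ 2 = 2 * Y * X"
      using psi_square[OF q] by (simp add: X_def Y_def)
    have ev: "\<forall>\<^sub>F z in nhds q. norm z < 1"
      using eventually_nhds_in_open[of "ball 0 1" q] q by simp
    have dX: "((\<lambda>z. theta3 (z\<^sup>2)) has_field_derivative x * (2 * q)) (at q)"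
      unfolding x_def
      by (rule DERIV_chain2[where f = theta3 and g = "\<lambda>z. z\<^sup>2", OF has_field_derivative_theta3[OF q2]]) (auto intro!: derivative_eq_intros)
    have dY: "((\<lambda>z. psi (z\<^sup>2)) has_field_derivative y * (2 * q)) (at q)"
      unfolding y_def
      by (rule DERIV_chain2[where f = psi and g = "\<lambda>z. z\<^sup>2", OF has_field_derivative_psi[OF q2]]) (auto intro!: derivative_eq_intros)
    have "((\<lambda>z. theta3 z ^ 2) has_field_derivative 2 * theta3 q * deriv theta3 q) (at q)"
      by (auto intro!: derivative_eq_intros has_field_derivative_theta3 q)
    moreover have "((\<lambda>z. theta3 (z\<^sup>2) ^ 2 + z * psi (z\<^sup>2) ^ 2) has_field_derivative
        (4 * q * X * x + Y\<^sup>2 + 4 * q\<^sup>2 * Y * y)) (at q)"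
      by (rule derivative_eq_intros dX dY refl)+
         (simp add: X_def Y_def power2_eq_square algebra_simps)
    hence "((\<lambda>z. theta3 z ^ 2) has_field_derivative
        (4 * q * X * x + Y\<^sup>2 + 4 * q\<^sup>2 * Y * y)) (at q)"
      using ev by (subst DERIV_cong_ev[OF refl _ refl]) (auto elim!: eventually_mono simp: theta3_square)
    \<comment> \<open>Differentiating the duplication formula on both sides relates the derivatives
      at q and at q^2 without extracting a square root; \<open>dps\<close> is the analogue for
      \<open>psi\<close>.\<close>
    ultimately have dth: "2 * theta3 q * deriv theta3 q = 4 * q * X * x + Y\<^sup>2 + 4 * q\<^sup>2 * Y * y"
      by (rule DERIV_unique)
    have "((\<lambda>z. psi z ^ 2) has_field_derivative 2 * psi q * deriv psi q) (at q)"
      by (auto intro!: derivative_eq_intros has_field_derivative_psi q)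
    moreover have "((\<lambda>z. 2 * psi (z\<^sup>2) * theta3 (z\<^sup>2)) has_field_derivative
        (4 * q * (y * X + Y * x))) (at q)"
      by (rule derivative_eq_intros dX dY refl)+
         (simp add: X_def Y_def power2_eq_square algebra_simps)
    hence "((\<lambda>z. psi z ^ 2) has_field_derivative (4 * q * (y * X + Y * x))) (at q)"
      using ev by (subst DERIV_cong_ev[OF refl _ refl]) (auto elim!: eventually_mono simp: psi_square)
    ultimately have dps: "2 * psi q * deriv psi q = 4 * q * (y * X + Y * x)"
      by (rule DERIV_unique)
    have "4 * q * deriv psi q / psi q = 2 * q * (2 * psi q * deriv psi q) / psi q ^ 2"
      using nz by (simp add: field_simps power2_eq_square)
    also have "\<dots> = 4 * q\<^sup>2 * (y / Y + x / X)"
      unfolding dps ps using nz by (simp add: field_simps power2_eq_square)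
    finally have lps: "4 * q * deriv psi q / psi q = 4 * q\<^sup>2 * (y / Y + x / X)" .
    have "4 * q * deriv theta3 q / theta3 q = 2 * q * (2 * theta3 q * deriv theta3 q) / theta3 q ^ 2"
      using nz by (simp add: field_simps power2_eq_square)
    hence lth: "4 * q * deriv theta3 q / theta3 q * theta3 q ^ 2 =
        2 * q * (4 * q * X * x + Y\<^sup>2 + 4 * q\<^sup>2 * Y * y)"
      unfolding dth using nz by simp
    \<comment> \<open>The transformation law of \<open>E\<close> under squaring. Division by the
      powers of theta3(q) and theta3(-q), followed by the product formula, makes it the claimed
      invariance.\<close>
    have "E q * theta3 q ^ 2 =
        (1 + 4 * q\<^sup>2 * (y / Y + x / X)) * theta3 q ^ 2 -
        2 * q * (4 * q * X * x + Y\<^sup>2 + 4 * q\<^sup>2 * Y * y)"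
      unfolding E_def lps using lth by (simp add: algebra_simps)
    also have "\<dots> = theta3 (- q) ^ 2 * E (q\<^sup>2)"
      unfolding th th4 E_def X_def[symmetric] Y_def[symmetric] x_def[symmetric] y_def[symmetric]
      using nz by (simp add: field_simps power2_eq_square)
    finally have "E q = theta3 (- q) ^ 2 * E (q\<^sup>2) / theta3 q ^ 2"
      using nz by (simp add: field_simps)
    hence "E q / theta3 (- q) ^ 4 = E (q\<^sup>2) / (theta3 q ^ 2 * theta3 (- q) ^ 2)"
      using nz by (simp add: field_simps power2_eq_square power4_eq_xxxx)
    thus "E q / theta3 (- q) ^ 4 = E (q\<^sup>2) / theta3 (- (q\<^sup>2)) ^ 4"
      using theta3_square_mult_theta3_minus_square[OF q] by simp
  qed
  \<comment> \<open>The constant value of the quotient is its value at 0, where the terms of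
    \<open>E\<close> with a factor q vanish and theta3 is 1.\<close>
  hence "E q = theta3 (- q) ^ 4"
    using theta3_nonzero[of "- q"] q by (simp add: E_def field_simps)
  thus ?thesis by (simp add: E_def)
qed

subsection \<open>Jacobi's triple product\<close>

text \<open>This is the q-Pochhammer symbol (q; q)_n; \<open>euler_phi\<close> is its limit (q;
  q)_infinity.\<close>

definition qprod :: "complex \<Rightarrow> nat \<Rightarrow> complex" where
  "qprod q n = (\<Prod>i<n. 1 - q ^ Suc i)"

definition euler_phi :: "complex \<Rightarrow> complex" where
  "euler_phi q = (\<Prod>i. 1 - q ^ Suc i)"

section \<open>Finite and infinite Euler products\<close>

lemma power_Suc_neq_1:
  fixes q :: complex
  assumes "norm q < 1"
  shows "q ^ Suc i \<noteq> 1"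
proof
  assume "q ^ Suc i = 1"
  hence "norm q ^ Suc i = 1"
    by (metis norm_one norm_power)
  thus False
    using assms power_Suc_less_one[of "norm q" i] by (cases "norm q = 0") auto
qed

lemma qprod_nonzero:
  assumes "norm q < 1"
  shows "qprod q n \<noteq> 0"
  using power_Suc_neq_1[OF assms] by (simp add: qprod_def del: power_Suc)

lemma convergent_prod_euler:
  fixes q :: complex
  assumes "norm q < 1"
  shows "convergent_prod (\<lambda>i. 1 - q ^ Suc i)"
proof -
  have "summable (\<lambda>i. norm ((1 - q ^ Suc i) - 1))"
    using summable_mult[OF summable_geometric[of "norm q"], of "norm q"] assms
    by (simp add: norm_power norm_mult)
  thus ?thesis
    by (intro abs_convergent_prod_imp_convergent_prod summable_imp_abs_convergent_prod)
qed

lemma qprod_LIMSEQ: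
  assumes "norm q < 1"
  shows "qprod q \<longlonglongrightarrow> euler_phi q"
proof -
  have "(\<lambda>i. 1 - q ^ Suc i) has_prod euler_phi q"
    unfolding euler_phi_def by (intro convergent_prod_has_prod convergent_prod_euler assms)
  from has_prod_imp_tendsto'[OF this] show ?thesis
    by (simp add: qprod_def[abs_def])
qed

lemma euler_phi_nonzero:
  assumes "norm q < 1"
  shows "euler_phi q \<noteq> 0"
  unfolding euler_phi_def
  using convergent_prod_euler[OF assms] power_Suc_neq_1[OF assms]
  by (intro prodinf_nonzero) (auto simp del: power_Suc)

text \<open>Extended by zero to negative integers, so that \<open>qrecip_diff_1\<close> holds without exception.\<close>

definition qrecip :: "complex \<Rightarrow> int \<Rightarrow> complex" where
  "qrecip q m = (if m < 0 then 0 else 1 / qprod q (nat m))"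

text \<open>For positive \<open>m\<close> the last factor of the product cancels. For
  \<open>m = 0\<close> the factor \<open>1 - q powi m\<close> vanishes, in agreement with the value
  0 at -1.\<close>

lemma qrecip_diff_1:
  assumes "norm q < 1"
  shows "qrecip q (m - 1) = (1 - q powi m) * qrecip q m"
proof -
  consider "m < 0" | "m = 0" | i where "m = int (Suc i)"
    by (metis int_cases not0_implies_Suc of_nat_0 negative_zless)
  thus ?thesis
  proof cases
    case 3
    have *: "nat (int (Suc i) - 1) = i" "nat (int (Suc i)) = Suc i" by auto
    have "\<not> int (Suc i) - 1 < 0" "\<not> int (Suc i) < 0" by auto
    thus ?thesis
      unfolding 3 qrecip_def * power_int_of_nat
      using power_Suc_neq_1[OF assms, of i]
      by (simp add: qprod_def del: power_Suc of_nat_Suc)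
  qed (auto simp: qrecip_def)
qed

text \<open>This is q^(k^2) times the Gaussian binomial coefficient of 2n over n + k in base q^2;
  the convention in \<open>qrecip\<close> makes it vanish for |k| > n.\<close>

definition tp_coeff :: "complex \<Rightarrow> nat \<Rightarrow> int \<Rightarrow> complex" where
  "tp_coeff q n k =
     q powi k\<^sup>2 * qprod (q\<^sup>2) (2 * n) * qrecip (q\<^sup>2) (int n - k) * qrecip (q\<^sup>2) (int n + k)"

text \<open>The recurrence compares coefficients of z^k when the finite product is multiplied by (1
  + z w)(1 + w / z) = 1 + w^2 + w z + w / z with w = q^(2n + 1).\<close>

lemma tp_coeff_Suc:
  assumes q: "norm q < 1" "q \<noteq> 0"
  shows "tp_coeff q (Suc n) k = (1 + q ^ (4 * n + 2)) * tp_coeff q n k +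
     q ^ (2 * n + 1) * tp_coeff q n (k - 1) + q ^ (2 * n + 1) * tp_coeff q n (k + 1)"
proof -
  define p where "p = q\<^sup>2"
  have p: "norm p < 1" "p \<noteq> 0"
    using q by (simp_all add: p_def norm_power power_less_one_iff)
  \<comment> \<open>All reciprocal products that occur are \<open>R\<close> or \<open>S\<close>
    times factors in \<open>x\<close>, \<open>y\<close> and \<open>p\<close>, so the recurrence
    becomes a rational identity. This holds for every \<open>k\<close>, including those where a
    coefficient vanishes.\<close>
  define x y where "x = p powi (int (Suc n) - k)" and "y = p powi (int (Suc n) + k)"
  define R S where "R = qrecip p (int (Suc n) - k)" and "S = qrecip p (int (Suc n) + k)"
  note rec = qrecip_diff_1[OF p(1)]
  have R: "qrecip p (int n - k) = (1 - x) * R"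
    using rec[of "int (Suc n) - k"] by (simp add: x_def R_def algebra_simps)
  have S: "qrecip p (int n + k) = (1 - y) * S"
    using rec[of "int (Suc n) + k"] by (simp add: y_def S_def algebra_simps)
  have xp: "p powi (int n - k) = x / p"
    using p power_int_diff[of p "int (Suc n) - k" 1] by (simp add: x_def algebra_simps)
  have yp: "p powi (int n + k) = y / p"
    using p power_int_diff[of p "int (Suc n) + k" 1] by (simp add: y_def algebra_simps)
  have R': "qrecip p (int n - (k + 1)) = (1 - x / p) * (1 - x) * R"
    using rec[of "int n - k"] by (simp only: xp R diff_diff_eq mult.assoc)
  have S': "qrecip p (int n + (k - 1)) = (1 - y / p) * (1 - y) * S"
    using rec[of "int n + k"] by (simp only: yp S add_diff_eq mult.assoc)
  have R1: "qrecip p (int n - (k - 1)) = R" and S1: "qrecip p (int n + (k + 1)) = S"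
    by (simp_all add: R_def S_def algebra_simps)
  have pint: "p powi m = q powi (2 * m)" for m
    unfolding p_def by (simp add: power_int_mult)
  have xy: "x * y = p ^ (2 * n + 2)"
  proof -
    have "x * y = p powi (int (2 * n + 2))"
      unfolding x_def y_def using p by (simp flip: power_int_add add: algebra_simps)
    thus ?thesis by (simp only: power_int_of_nat)
  qed
  have "q ^ (4 * n + 2) = p ^ (2 * n + 1)"
    unfolding p_def power_mult[symmetric] by (rule arg_cong) simp
  moreover have "p ^ (2 * n + 1) = x * y / p"
    using p by (simp add: xy)
  ultimately have qxy: "p ^ (2 * n + 2) = x * y" "p ^ (2 * n + 1) = x * y / p"
    "q ^ (4 * n + 2) = x * y / p"
    by (simp_all only: xy)
  have Q: "qprod p (2 * Suc n) = qprod p (2 * n) * (1 - x * y / p) * (1 - x * y)"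
    using qxy by (simp add: qprod_def)
  \<comment> \<open>Completing the square: 2n + 1 + (k - 1)^2 = k^2 + 2(n + 1 - k), so the shift of
    \<open>k\<close> costs exactly the factor \<open>x\<close>, and the opposite shift the factor
    \<open>y\<close>.\<close>
  have sq1: "q ^ (2 * n + 1) * q powi (k - 1)\<^sup>2 = q powi k\<^sup>2 * x"
  proof -
    have "q ^ (2 * n + 1) * q powi (k - 1)\<^sup>2 = q powi (int (2 * n + 1) + (k - 1)\<^sup>2)"
      by (simp only: power_int_add[OF disjI1[OF q(2)]] power_int_of_nat)
    also have "int (2 * n + 1) + (k - 1)\<^sup>2 = k\<^sup>2 + 2 * (int (Suc n) - k)"
      by (simp add: power2_eq_square algebra_simps)
    also have "q powi \<dots> = q powi k\<^sup>2 * x"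
      by (simp only: power_int_add[OF disjI1[OF q(2)]] pint x_def)
    finally show ?thesis .
  qed
  have sq2: "q ^ (2 * n + 1) * q powi (k + 1)\<^sup>2 = q powi k\<^sup>2 * y"
  proof -
    have "q ^ (2 * n + 1) * q powi (k + 1)\<^sup>2 = q powi (int (2 * n + 1) + (k + 1)\<^sup>2)"
      by (simp only: power_int_add[OF disjI1[OF q(2)]] power_int_of_nat)
    also have "int (2 * n + 1) + (k + 1)\<^sup>2 = k\<^sup>2 + 2 * (int (Suc n) + k)"
      by (simp add: power2_eq_square algebra_simps)
    also have "q powi \<dots> = q powi k\<^sup>2 * y"
      by (simp only: power_int_add[OF disjI1[OF q(2)]] pint y_def)
    finally show ?thesis .
  qed
  have m: "q ^ (2 * n + 1) * tp_coeff q n (k - 1) =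
      q powi k\<^sup>2 * x * qprod p (2 * n) * R * ((1 - y / p) * (1 - y) * S)"
    unfolding tp_coeff_def p_def[symmetric] R1 S' sq1[symmetric] by (simp only: mult.assoc)
  have l: "q ^ (2 * n + 1) * tp_coeff q n (k + 1) =
      q powi k\<^sup>2 * y * qprod p (2 * n) * ((1 - x / p) * (1 - x) * R) * S"
    unfolding tp_coeff_def p_def[symmetric] S1 R' sq2[symmetric] by (simp only: mult.assoc)
  have c: "tp_coeff q (Suc n) k =
      q powi k\<^sup>2 * (qprod p (2 * n) * (1 - x * y / p) * (1 - x * y)) * R * S"
    unfolding tp_coeff_def p_def[symmetric] Q R_def S_def ..
  have d: "tp_coeff q n k = q powi k\<^sup>2 * qprod p (2 * n) * ((1 - x) * R) * ((1 - y) * S)"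
    unfolding tp_coeff_def p_def[symmetric] R S ..
  \<comment> \<open>This is the recurrence without its common factor.\<close>
  have "(1 - x * y / p) * (1 - x * y) =
      (1 + x * y / p) * (1 - x) * (1 - y) + x * (1 - y / p) * (1 - y) + y * (1 - x / p) * (1 - x)"
    using p by (simp add: field_simps)
  hence "q powi k\<^sup>2 * qprod p (2 * n) * R * S * ((1 - x * y / p) * (1 - x * y)) =
      q powi k\<^sup>2 * qprod p (2 * n) * R * S *
      ((1 + x * y / p) * (1 - x) * (1 - y) + x * (1 - y / p) * (1 - y) + y * (1 - x / p) * (1 - x))"
    by (rule arg_cong)
  thus ?thesis
    unfolding m l c d qxy by (simp only: distrib_left distrib_right mult_ac)
qed

lemma tp_coeff_0: "tp_coeff q 0 k = (if k = 0 then 1 else 0)"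
  by (auto simp: tp_coeff_def qrecip_def qprod_def)

text \<open>Induction on \<open>n\<close> with \<open>tp_coeff_Suc\<close>. Summing over all
  integers, although only finitely many coefficients are nonzero, makes the index shifts by one
  plain bijections.\<close>

theorem finite_triple_product:
  assumes q: "norm q < 1" "q \<noteq> 0" and z: "z \<noteq> 0"
  shows "((\<lambda>k. tp_coeff q n k * z powi k) has_sum
     (\<Prod>j<n. (1 + z * q ^ (2 * j + 1)) * (1 + q ^ (2 * j + 1) / z))) UNIV"
proof (induction n)
  case 0
  show ?case
    by (rule has_sum_finite_neutralI[of "{0}"]) (auto simp: tp_coeff_0)
next
  case (Suc n)
  define P where "P = (\<Prod>j<n. (1 + z * q ^ (2 * j + 1)) * (1 + q ^ (2 * j + 1) / z))"
  define w where "w = q ^ (2 * n + 1)"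
  have w2: "q ^ (4 * n + 2) = w * w"
    unfolding w_def by (simp flip: power_add)
  have IH: "((\<lambda>k. tp_coeff q n k * z powi k) has_sum P) UNIV"
    using Suc by (simp add: P_def)
  have "bij_betw (\<lambda>k::int. k - 1) UNIV UNIV" "bij_betw (\<lambda>k::int. k + 1) UNIV UNIV"
    by (rule bij_betwI[of _ _ _ "\<lambda>k. k + 1"]; simp) (rule bij_betwI[of _ _ _ "\<lambda>k. k - 1"]; simp)
  hence down: "((\<lambda>k. tp_coeff q n (k - 1) * z powi (k - 1)) has_sum P) UNIV"
    and up: "((\<lambda>k. tp_coeff q n (k + 1) * z powi (k + 1)) has_sum P) UNIV"
    using IH by (simp_all add: has_sum_reindex_bij_betw[where f = "\<lambda>k. tp_coeff q n k * z powi k"])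
  have "((\<lambda>k. (1 + w * w) * (tp_coeff q n k * z powi k) +
      w * z * (tp_coeff q n (k - 1) * z powi (k - 1)) +
      w / z * (tp_coeff q n (k + 1) * z powi (k + 1))) has_sum
      ((1 + w * w) * P + w * z * P + w / z * P)) UNIV"
    by (intro has_sum_add has_sum_cmult_right IH down up)
  also have "(\<lambda>k. (1 + w * w) * (tp_coeff q n k * z powi k) +
      w * z * (tp_coeff q n (k - 1) * z powi (k - 1)) +
      w / z * (tp_coeff q n (k + 1) * z powi (k + 1))) = (\<lambda>k. tp_coeff q (Suc n) k * z powi k)"
  proof
    fix k
    have "z powi (k - 1) = z powi k / z" "z powi (k + 1) = z powi k * z"
      using z by (simp_all add: power_int_diff power_int_add)
    thus "(1 + w * w) * (tp_coeff q n k * z powi k) +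
      w * z * (tp_coeff q n (k - 1) * z powi (k - 1)) +
      w / z * (tp_coeff q n (k + 1) * z powi (k + 1)) = tp_coeff q (Suc n) k * z powi k"
      unfolding tp_coeff_Suc[OF q] w2 w_def[symmetric] using z by (simp add: field_simps)
  qed
  also have "(1 + w * w) * P + w * z * P + w / z * P =
      (\<Prod>j<Suc n. (1 + z * q ^ (2 * j + 1)) * (1 + q ^ (2 * j + 1) / z))"
    unfolding prod.lessThan_Suc P_def[symmetric] w_def[symmetric] using z by (simp add: field_simps)
  finally show ?case .
qed

section \<open>Passage to the limit in the finite triple product\<close>

lemma qrecip_bounded:
  assumes "norm q < 1"
  obtains C where "C > 0" "\<And>m. norm (qrecip q m) \<le> C"
proof -
  have "(\<lambda>n. 1 / qprod q n) \<longlonglongrightarrow> 1 / euler_phi q"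
    by (intro tendsto_intros qprod_LIMSEQ euler_phi_nonzero assms)
  hence "Bseq (\<lambda>n. 1 / qprod q n)"
    by (rule convergent_imp_Bseq[OF convergentI])
  then obtain C where "C > 0" "\<And>n. norm (1 / qprod q n) \<le> C"
    by (auto simp: Bseq_def)
  thus ?thesis
    by (intro that[of C]) (auto simp: qrecip_def)
qed

text \<open>The bound is uniform in \<open>n\<close> and provides the majorant for Tannery's
  theorem.\<close>

lemma tp_coeff_bounded:
  assumes q: "norm q < 1"
  obtains C where "\<And>n k. norm (tp_coeff q n k) \<le> C * norm (q powi k\<^sup>2)"
proof -
  have p: "norm (q\<^sup>2) < 1"
    using q by (simp add: norm_power power_less_one_iff)
  obtain C where C: "C > 0" "\<And>m. norm (qrecip (q\<^sup>2) m) \<le> C"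
    using qrecip_bounded[OF p] by blast
  obtain B where B: "B > 0" "\<And>n. norm (qprod (q\<^sup>2) n) \<le> B"
    using convergent_imp_Bseq[OF convergentI[OF qprod_LIMSEQ[OF p]]] by (auto simp: Bseq_def)
  have "norm (tp_coeff q n k) \<le> B * C * C * norm (q powi k\<^sup>2)" for n k
  proof -
    have "norm (qprod (q\<^sup>2) (2 * n)) * norm (qrecip (q\<^sup>2) (int n - k)) *
        norm (qrecip (q\<^sup>2) (int n + k)) \<le> B * C * C"
      using B C by (intro mult_mono) auto
    thus ?thesis
      unfolding tp_coeff_def norm_mult
      by (auto dest: mult_left_mono[of _ _ "norm (q powi k\<^sup>2)"] simp: mult_ac)
  qed
  thus ?thesis by (rule that)
qed

text \<open>Each of the three products tends to \<open>euler_phi\<close> at q^2, once in the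
  numerator and twice in the denominator.\<close>

lemma tp_coeff_LIMSEQ:
  assumes q: "norm q < 1"
  shows "(\<lambda>n. tp_coeff q n k) \<longlonglongrightarrow> q powi k\<^sup>2 / euler_phi (q\<^sup>2)"
proof -
  define p where "p = q\<^sup>2"
  have p: "norm p < 1"
    using q by (simp add: p_def norm_power power_less_one_iff)
  note nz = euler_phi_nonzero[OF p]
  have recip: "(\<lambda>n. qrecip p (int n + j)) \<longlonglongrightarrow> 1 / euler_phi p" for j
  proof -
    have "(\<lambda>n. 1 / qprod p n) \<longlonglongrightarrow> 1 / euler_phi p"
      by (intro tendsto_intros qprod_LIMSEQ p nz)
    moreover have "filterlim (\<lambda>n. nat (int n + j)) sequentially sequentially"
    proof (subst filterlim_at_top, intro allI)
      fix N :: nat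
      show "\<forall>\<^sub>F n in sequentially. N \<le> nat (int n + j)"
        using eventually_ge_at_top[of "N + nat \<bar>j\<bar>"] by eventually_elim linarith
    qed
    ultimately have "(\<lambda>n. 1 / qprod p (nat (int n + j))) \<longlonglongrightarrow> 1 / euler_phi p"
      by (rule filterlim_compose)
    moreover have "\<forall>\<^sub>F n in sequentially. qrecip p (int n + j) = 1 / qprod p (nat (int n + j))"
      using eventually_ge_at_top[of "nat \<bar>j\<bar>"] by eventually_elim (auto simp: qrecip_def)
    ultimately show ?thesis
      by (simp add: tendsto_cong)
  qed
  have "filterlim (\<lambda>n. 2 * n) sequentially (sequentially :: nat filter)"
    by (rule filterlim_subseq) (auto intro: strict_monoI)
  from filterlim_compose[OF qprod_LIMSEQ[OF p] this]
  have "(\<lambda>n. qprod p (2 * n)) \<longlonglongrightarrow> euler_phi p" .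
  hence "(\<lambda>n. tp_coeff q n k) \<longlonglongrightarrow>
      q powi k\<^sup>2 * euler_phi p * (1 / euler_phi p) * (1 / euler_phi p)"
    unfolding tp_coeff_def p_def[symmetric]
    using recip[of "- k"] recip[of k] by (intro tendsto_intros) simp_all
  thus ?thesis using nz by (simp add: p_def)
qed

text \<open>The M-test makes the convergence over finite index sets uniform in \<open>n\<close>, so
  the two limits may be interchanged.\<close>

lemma tannery_infsum:
  fixes f :: "nat \<Rightarrow> 'b \<Rightarrow> 'c :: banach"
  assumes lim: "\<And>k. (\<lambda>n. f n k) \<longlonglongrightarrow> g k"
    and bound: "\<And>n k. norm (f n k) \<le> M k"
    and M: "M summable_on UNIV"
  shows "(\<lambda>n. \<Sum>\<^sub>\<infinity>k\<in>UNIV. f n k) \<longlonglongrightarrow> (\<Sum>\<^sub>\<infinity>k\<in>UNIV. g k)"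
proof (rule swap_uniform_limit')
  show "uniform_limit UNIV (\<lambda>X n. \<Sum>k\<in>X. f n k) (\<lambda>n. \<Sum>\<^sub>\<infinity>k\<in>UNIV. f n k)
      (finite_subsets_at_top UNIV)"
    by (rule Weierstrass_m_test_general[OF _ M]) (rule bound)
  show "\<forall>\<^sub>F X in finite_subsets_at_top UNIV. (\<lambda>n. \<Sum>k\<in>X. f n k) \<longlonglongrightarrow> (\<Sum>k\<in>X. g k)"
    by (intro always_eventually allI tendsto_sum lim)
  have "norm (g k) \<le> M k" for k
    by (rule tendsto_upperbound[OF tendsto_norm[OF lim]]) (auto simp: bound)
  hence "g summable_on UNIV"
    by (intro Infinite_Sum.abs_summable_summable[OF Infinite_Sum.abs_summable_on_comparison_test'[OF M]])
  thus "((\<lambda>X. \<Sum>k\<in>X. g k) \<longlongrightarrow> (\<Sum>\<^sub>\<infinity>k\<in>UNIV. g k)) (finite_subsets_at_top UNIV)"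
    by (rule infsum_tendsto)
qed auto

text \<open>Jacobi's triple product, with the partial products kept explicit so that they can be
  rewritten through \<open>qprod\<close> at special \<open>z\<close>.\<close>

theorem triple_product_LIMSEQ:
  assumes q: "norm q < 1" "q \<noteq> 0" and z: "z \<noteq> 0"
    and summable: "(\<lambda>k. norm (q powi k\<^sup>2 * z powi k)) summable_on UNIV"
  shows "(\<lambda>n. \<Prod>j<n. (1 + z * q ^ (2 * j + 1)) * (1 + q ^ (2 * j + 1) / z)) \<longlonglongrightarrow>
     (\<Sum>\<^sub>\<infinity>k\<in>UNIV. q powi k\<^sup>2 * z powi k) / euler_phi (q\<^sup>2)"
proof -
  obtain C where C: "\<And>n k. norm (tp_coeff q n k) \<le> C * norm (q powi k\<^sup>2)"
    using tp_coeff_bounded[OF q(1)] by blast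
  have "(\<lambda>n. \<Sum>\<^sub>\<infinity>k\<in>UNIV. tp_coeff q n k * z powi k) \<longlonglongrightarrow>
      (\<Sum>\<^sub>\<infinity>k\<in>UNIV. q powi k\<^sup>2 / euler_phi (q\<^sup>2) * z powi k)"
  proof (rule tannery_infsum)
    show "(\<lambda>n. tp_coeff q n k * z powi k) \<longlonglongrightarrow> q powi k\<^sup>2 / euler_phi (q\<^sup>2) * z powi k" for k
      by (intro tendsto_intros tp_coeff_LIMSEQ q)
    show "norm (tp_coeff q n k * z powi k) \<le> C * norm (q powi k\<^sup>2 * z powi k)" for n k
      using mult_right_mono[OF C[of n k], of "norm (z powi k)"] by (simp add: norm_mult mult_ac)
    show "(\<lambda>k. C * norm (q powi k\<^sup>2 * z powi k)) summable_on UNIV"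
      by (intro summable_on_cmult_right summable)
  qed
  also have "(\<lambda>n. \<Sum>\<^sub>\<infinity>k\<in>UNIV. tp_coeff q n k * z powi k) =
      (\<lambda>n. \<Prod>j<n. (1 + z * q ^ (2 * j + 1)) * (1 + q ^ (2 * j + 1) / z))"
    by (intro ext infsumI finite_triple_product q z)
  also have "(\<lambda>k. q powi k\<^sup>2 / euler_phi (q\<^sup>2) * z powi k) =
      (\<lambda>k. inverse (euler_phi (q\<^sup>2)) * (q powi k\<^sup>2 * z powi k))"
    by (simp add: field_simps)
  also have "(\<Sum>\<^sub>\<infinity>k\<in>UNIV. inverse (euler_phi (q\<^sup>2)) * (q powi k\<^sup>2 * z powi k)) =
      (\<Sum>\<^sub>\<infinity>k\<in>UNIV. q powi k\<^sup>2 * z powi k) / euler_phi (q\<^sup>2)"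
    by (simp only: infsum_cmult_right') (simp add: field_simps)
  finally show ?thesis .
qed

subsection \<open>The eta quotient and the theorem\<close>

lemma qprod_even:
  "qprod q (2 * n) = (\<Prod>j<n. 1 - q ^ (2 * j + 1)) * qprod (q\<^sup>2) n"
proof (induction n)
  case (Suc n)
  have "qprod q (2 * Suc n) = qprod q (2 * n) * (1 - q ^ (2 * n + 1)) * (1 - q ^ (2 * n + 2))"
    by (simp add: qprod_def)
  also have "q ^ (2 * n + 2) = (q\<^sup>2) ^ Suc n"
    unfolding power_mult[symmetric] by (rule arg_cong) simp
  finally show ?case
    unfolding Suc by (simp add: qprod_def del: power_Suc)
qed (simp add: qprod_def)

lemma LIMSEQ_double:
  assumes "f \<longlonglongrightarrow> L"
  shows "(\<lambda>n. f (2 * n)) \<longlonglongrightarrow> L"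
proof -
  have "filterlim (\<lambda>n. 2 * n) sequentially (sequentially :: nat filter)"
    by (rule filterlim_subseq) (auto intro: strict_monoI)
  from filterlim_compose[OF assms this] show ?thesis .
qed

text \<open>The triple product at z = -1. Its two factors coincide, and the product over odd
  exponents is a quotient of \<open>qprod\<close> values by \<open>qprod_even\<close>.\<close>

theorem theta3_minus_eq_euler_phi:
  assumes q: "norm q < 1" "q \<noteq> 0"
  shows "theta3 (- q) = euler_phi q ^ 2 / euler_phi (q\<^sup>2)"
proof -
  have q2: "norm (q\<^sup>2) < 1"
    using q by (simp add: norm_power power_less_one_iff)
  note nz = euler_phi_nonzero[OF q2]
  \<comment> \<open>The integers k and k^2 have the same parity.\<close>
  have summand: "q powi k\<^sup>2 * (- 1) powi k = (- q) ^ nat (k\<^sup>2)" for k :: int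
  proof -
    have "q powi k\<^sup>2 * (- 1) powi k = (- q) powi k\<^sup>2"
      by (simp add: power_int_minus_left)
    thus ?thesis by (simp add: power_int_def)
  qed
  have "(\<lambda>k::int. norm ((- q) ^ nat (k\<^sup>2))) summable_on UNIV"
    using q by (intro exponent_series_abs_summable admissible_square) simp
  hence "(\<lambda>n. \<Prod>j<n. (1 + - 1 * q ^ (2 * j + 1)) * (1 + q ^ (2 * j + 1) / (- 1))) \<longlonglongrightarrow>
     (\<Sum>\<^sub>\<infinity>k\<in>UNIV. q powi k\<^sup>2 * (- 1) powi k) / euler_phi (q\<^sup>2)"
    by (intro triple_product_LIMSEQ q) (simp_all only: summand, simp)
  also have "(\<Sum>\<^sub>\<infinity>k\<in>UNIV. q powi k\<^sup>2 * (- 1) powi k) = theta3 (- q)"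
    by (simp only: summand theta3_eq_exponent_series exponent_series_def)
  finally have 1: "(\<lambda>n. \<Prod>j<n. (1 + - 1 * q ^ (2 * j + 1)) * (1 + q ^ (2 * j + 1) / (- 1))) \<longlonglongrightarrow>
     theta3 (- q) / euler_phi (q\<^sup>2)" .
  have "(\<Prod>j<n. (1 + - 1 * q ^ (2 * j + 1)) * (1 + q ^ (2 * j + 1) / (- 1))) =
      (qprod q (2 * n) / qprod (q\<^sup>2) n)\<^sup>2" for n
    using qprod_nonzero[OF q2, of n]
    by (simp add: qprod_even power2_eq_square prod.distrib)
  hence 2: "(\<lambda>n. (qprod q (2 * n) / qprod (q\<^sup>2) n)\<^sup>2) \<longlonglongrightarrow> theta3 (- q) / euler_phi (q\<^sup>2)"
    using 1 by simp
  have "(\<lambda>n. (qprod q (2 * n) / qprod (q\<^sup>2) n)\<^sup>2) \<longlonglongrightarrow> (euler_phi q / euler_phi (q\<^sup>2))\<^sup>2"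
    by (intro tendsto_intros LIMSEQ_double qprod_LIMSEQ q q2 nz)
  with 2 have "theta3 (- q) / euler_phi (q\<^sup>2) = (euler_phi q / euler_phi (q\<^sup>2))\<^sup>2"
    by (rule LIMSEQ_unique)
  thus ?thesis
    using nz by (simp add: field_simps power2_eq_square)
qed

text \<open>The triple product at z = q has factors 1 + q^(2j + 2) and 1 + q^(2j), the latter equal
  to 2 for j = 0. Writing 1 + u = (1 - u^2) / (1 - u) turns them into Euler products.\<close>

theorem psi_eq_euler_phi:
  assumes q: "norm q < 1" "q \<noteq> 0"
  shows "psi q = 2 * euler_phi (q ^ 4) ^ 2 / euler_phi (q\<^sup>2)"
proof -
  have q2: "norm (q\<^sup>2) < 1" and q4: "norm (q ^ 4) < 1"
    using q by (simp_all add: norm_power power_less_one_iff)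
  note nz = euler_phi_nonzero[OF q2]
  have summand: "q powi k\<^sup>2 * q powi k = q ^ nat (k\<^sup>2 + k)" for k :: int
  proof -
    have "q powi k\<^sup>2 * q powi k = q powi (k\<^sup>2 + k)"
      using q by (simp add: power_int_add)
    thus ?thesis using pronic_nonneg[of k] by (simp add: power_int_def)
  qed
  have "(\<lambda>k::int. norm (q ^ nat (k\<^sup>2 + k))) summable_on UNIV"
    by (intro exponent_series_abs_summable admissible_pronic q)
  hence "(\<lambda>n. \<Prod>j<n. (1 + q * q ^ (2 * j + 1)) * (1 + q ^ (2 * j + 1) / q)) \<longlonglongrightarrow>
     (\<Sum>\<^sub>\<infinity>k\<in>UNIV. q powi k\<^sup>2 * q powi k) / euler_phi (q\<^sup>2)"
    by (intro triple_product_LIMSEQ q) (simp_all only: summand)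
  also have "(\<Sum>\<^sub>\<infinity>k\<in>UNIV. q powi k\<^sup>2 * q powi k) = psi q"
    by (simp only: summand psi_def exponent_series_def)
  \<comment> \<open>The second family lags one index behind the first. The extra factor, which tends
    to 1, supplies its missing last term, so that the product is exactly twice a square.\<close>
  finally have "(\<lambda>n. (\<Prod>j<n. (1 + q * q ^ (2 * j + 1)) * (1 + q ^ (2 * j + 1) / q)) * (1 + (q\<^sup>2) ^ n))
      \<longlonglongrightarrow> psi q / euler_phi (q\<^sup>2) * (1 + 0)"
    by (intro tendsto_intros LIMSEQ_power_zero q2)
  moreover have "(\<Prod>j<n. (1 + q * q ^ (2 * j + 1)) * (1 + q ^ (2 * j + 1) / q)) * (1 + (q\<^sup>2) ^ n) =
      2 * (qprod (q ^ 4) n / qprod (q\<^sup>2) n)\<^sup>2" for n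
  proof (induction n)
    case (Suc n)
    define y where "y = (q\<^sup>2) ^ n"
    have y: "q * q ^ (2 * n + 1) = y * q\<^sup>2" "q ^ (2 * n + 1) / q = y"
      using q by (simp_all add: y_def power_mult) (simp add: power2_eq_square)
    have S: "(q\<^sup>2) ^ Suc n = y * q\<^sup>2" "(q ^ 4) ^ Suc n = (y * q\<^sup>2)\<^sup>2"
      unfolding y_def by (simp_all add: power_mult_distrib mult_ac flip: power_mult)
    have ynz: "1 - y * q\<^sup>2 \<noteq> 0"
      using power_Suc_neq_1[OF q2, of n] unfolding S by simp
    have "(qprod (q ^ 4) (Suc n) / qprod (q\<^sup>2) (Suc n)) =
        qprod (q ^ 4) n / qprod (q\<^sup>2) n * ((1 - (y * q\<^sup>2)\<^sup>2) / (1 - y * q\<^sup>2))"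
      unfolding qprod_def prod.lessThan_Suc S by simp
    also have "(1 - (y * q\<^sup>2)\<^sup>2) / (1 - y * q\<^sup>2) = 1 + y * q\<^sup>2"
      using ynz by (simp add: field_simps power2_eq_square)
    finally have R: "2 * (qprod (q ^ 4) (Suc n) / qprod (q\<^sup>2) (Suc n))\<^sup>2 =
        2 * (qprod (q ^ 4) n / qprod (q\<^sup>2) n)\<^sup>2 * (1 + y * q\<^sup>2)\<^sup>2"
      by (simp only: power_mult_distrib mult.assoc)
    show ?case
      unfolding prod.lessThan_Suc y S R Suc[symmetric] y_def[symmetric]
      by (simp only: power2_eq_square mult_ac)
  qed (simp add: qprod_def)
  ultimately have 1: "(\<lambda>n. 2 * (qprod (q ^ 4) n / qprod (q\<^sup>2) n)\<^sup>2) \<longlonglongrightarrow> psi q / euler_phi (q\<^sup>2)"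
    by simp
  have "(\<lambda>n. 2 * (qprod (q ^ 4) n / qprod (q\<^sup>2) n)\<^sup>2) \<longlonglongrightarrow>
      2 * (euler_phi (q ^ 4) / euler_phi (q\<^sup>2))\<^sup>2"
    by (intro tendsto_intros qprod_LIMSEQ q2 q4 nz)
  with 1 have "psi q / euler_phi (q\<^sup>2) = 2 * (euler_phi (q ^ 4) / euler_phi (q\<^sup>2))\<^sup>2"
    by (rule LIMSEQ_unique)
  thus ?thesis
    using nz by (simp add: field_simps power2_eq_square)
qed

lemma dedekind_eta_eq_euler_phi:
  assumes "exp (2 * of_real pi * \<i> * \<tau>) = q"
  shows "dedekind_eta \<tau> = exp (of_real pi * \<i> * \<tau> / 12) * euler_phi q"
proof -
  have "exp (2 * of_real pi * \<i> * of_nat (Suc k) * \<tau>) = q ^ Suc k" for k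
    unfolding assms[symmetric] exp_of_nat_mult[symmetric] by (simp only: mult_ac)
  thus ?thesis
    by (simp only: dedekind_eta_def euler_phi_def)
qed

text \<open>As Euler products, the two summands of the eta quotient are theta3(-q)^4 and 2 q
  psi(q)^4. The quartic identity then removes theta3(-q).\<close>

theorem A_eq:
  assumes q: "norm q < 1" "q \<noteq> 0"
  shows "A q = theta3 q ^ 4 + q * psi q ^ 4"
proof -
  define \<tau> where "\<tau> = Ln q / (2 * of_real pi * \<i>)"
  \<comment> \<open>A 24th root of q. The eta prefactors are w, w^2 and w^4, and w^32 = w^8 q, so
    that w^8 cancels from the quotient.\<close>
  define w where "w = exp (of_real pi * \<i> * \<tau> / 12)"
  have e1: "exp (2 * of_real pi * \<i> * \<tau>) = q"
    using q by (simp add: \<tau>_def)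
  have e2: "exp (2 * of_real pi * \<i> * (2 * \<tau>)) = q\<^sup>2"
    unfolding e1[symmetric] exp_of_nat_mult[symmetric] by (simp add: mult_ac)
  have e4: "exp (2 * of_real pi * \<i> * (4 * \<tau>)) = q ^ 4"
    unfolding e1[symmetric] exp_of_nat_mult[symmetric] by (simp add: mult_ac)
  have w2: "exp (of_real pi * \<i> * (2 * \<tau>) / 12) = w ^ 2"
    and w4: "exp (of_real pi * \<i> * (4 * \<tau>) / 12) = w ^ 4"
    and w24: "w ^ 24 = q"
    unfolding w_def e1[symmetric] exp_of_nat_mult[symmetric] by (simp_all add: mult_ac)
  have w: "w \<noteq> 0" by (simp add: w_def)
  have q2: "norm (q\<^sup>2) < 1"
    using q by (simp add: norm_power power_less_one_iff)
  define F where "F = euler_phi (q\<^sup>2)"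
  have F: "F \<noteq> 0"
    using euler_phi_nonzero[OF q2] by (simp add: F_def)
  have "w ^ 32 = w ^ 8 * q"
    unfolding w24[symmetric] by (simp flip: power_add)
  hence "A q = (w ^ 8 * (euler_phi q ^ 8 + 32 * q * euler_phi (q ^ 4) ^ 8)) / (w ^ 8 * F ^ 4)"
    unfolding A_def A_eta_def \<tau>_def[symmetric] dedekind_eta_eq_euler_phi[OF e1]
      dedekind_eta_eq_euler_phi[OF e2] dedekind_eta_eq_euler_phi[OF e4] w2 w4 w_def[symmetric]
      F_def[symmetric]
    by (simp add: power_mult_distrib algebra_simps flip: power_mult)
  also have "\<dots> = euler_phi q ^ 8 / F ^ 4 + 2 * q * (16 * euler_phi (q ^ 4) ^ 8 / F ^ 4)"
    using w F by (simp add: field_simps)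
  also have "\<dots> = theta3 (- q) ^ 4 + 2 * q * psi q ^ 4"
    unfolding theta3_minus_eq_euler_phi[OF q] psi_eq_euler_phi[OF q] F_def[symmetric]
    by (simp add: power_divide power_mult_distrib flip: power_mult)
  also have "\<dots> = theta3 q ^ 4 + q * psi q ^ 4"
    using jacobi_theta_quartic[OF q(1)] by simp
  finally show ?thesis .
qed

section \<open>The function \<open>alpha\<close> and the derivative of \<open>A\<close>\<close>

lemma theta2_power4:
  assumes q: "norm q < 1" "q \<noteq> 0"
  shows "theta2 q ^ 4 = q * psi q ^ 4"
proof -
  \<comment> \<open>As (k + 1/2)^2 = 1/4 + (k^2 + k), the principal fourth root of q splits off; its
    fourth power is q.\<close>
  have "q powr ((of_int k + 1 / 2)\<^sup>2) = q powr (1 / 4) * q ^ nat (k\<^sup>2 + k)" for k :: int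
  proof -
    have "(of_int k + 1 / 2)\<^sup>2 = (1 / 4 + of_nat (nat (k\<^sup>2 + k)) :: complex)"
      using pronic_nonneg[of k] by (simp add: power2_eq_square field_simps)
    thus ?thesis
      using q by (simp add: powr_add powr_nat')
  qed
  hence "theta2 q = q powr (1 / 4) * psi q"
    by (simp add: theta2_def psi_def exponent_series_def infsum_cmult_right')
  moreover have "(q powr (1 / 4)) ^ 4 = q"
    using q by (simp add: powr_def flip: exp_of_nat_mult)
  ultimately show ?thesis
    by (simp add: power_mult_distrib)
qed

lemma alpha_eq:
  assumes "norm q < 1" "q \<noteq> 0"
  shows "alpha q = q * psi q ^ 4 / theta3 q ^ 4"
  by (simp add: alpha_def theta2_power4 assms)

lemma A_eq_alpha:
  assumes "norm q < 1" "q \<noteq> 0"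
  shows "A q = theta3 q ^ 4 * (1 + alpha q)"
  using theta3_nonzero[OF assms(1)] by (simp add: A_eq alpha_eq assms field_simps)

text \<open>In the derivative of theta3^4 + q psi^4, \<open>logderiv_psi_theta3\<close> eliminates
  the derivative of \<open>psi\<close> and the quartic identity eliminates theta3(-q), so that only
  the derivative of \<open>theta3\<close> remains.\<close>

lemma has_field_derivative_A:
  assumes q: "norm q < 1" "q \<noteq> 0"
  shows "(A has_field_derivative deriv A q) (at q)"
    and "q * deriv A q = 4 * A q * (q * deriv theta3 q / theta3 q) +
           theta3 q ^ 8 * alpha q * (1 - alpha q)"
proof -
  have "q \<in> ball 0 1 - {0}" using q by simp
  hence ev: "\<forall>\<^sub>F z in nhds q. z \<in> ball 0 1 - {0}"
    by (intro eventually_nhds_in_open) auto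
  define d where "d = 4 * theta3 q ^ 3 * deriv theta3 q + psi q ^ 4 + q * (4 * psi q ^ 3 * deriv psi q)"
  have "((\<lambda>z. theta3 z ^ 4 + z * psi z ^ 4) has_field_derivative d) (at q)"
    unfolding d_def
    by (rule derivative_eq_intros has_field_derivative_theta3 has_field_derivative_psi q refl)+
       (simp add: algebra_simps)
  hence d: "(A has_field_derivative d) (at q)"
    using ev by (subst DERIV_cong_ev[OF refl _ refl]) (auto elim!: eventually_mono simp: A_eq)
  hence dd: "deriv A q = d" by (rule DERIV_imp_deriv)
  thus "(A has_field_derivative deriv A q) (at q)" using d by simp
  define T P V W where "T = theta3 q" and "P = psi q" and "V = q * deriv theta3 q / theta3 q"
    and "W = q * deriv psi q / psi q"
  have nz: "T \<noteq> 0" "P \<noteq> 0"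
    using q by (simp_all add: T_def P_def theta3_nonzero psi_nonzero)
  have m: "theta3 (- q) ^ 4 = T ^ 4 - q * P ^ 4"
    using jacobi_theta_quartic[OF q(1)] by (simp add: T_def P_def)
  have "1 + 4 * W - 4 * V = T ^ 4 - q * P ^ 4"
    using logderiv_psi_theta3[OF q(1)] unfolding m V_def W_def by (simp add: mult.assoc)
  hence W: "1 + 4 * W = T ^ 4 - q * P ^ 4 + 4 * V"
    by (simp add: algebra_simps)
  have "q * d = 4 * T ^ 4 * V + q * P ^ 4 * (1 + 4 * W)"
    using nz unfolding d_def T_def P_def V_def W_def by (simp add: field_simps eval_nat_numeral)
  also have "\<dots> = 4 * (T ^ 4 + q * P ^ 4) * V + q * P ^ 4 * (T ^ 4 - q * P ^ 4)"
    unfolding W by (simp add: algebra_simps)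
  also have "q * P ^ 4 * (T ^ 4 - q * P ^ 4) = T ^ 8 * alpha q * (1 - alpha q)"
    unfolding alpha_eq[OF q] T_def[symmetric] P_def[symmetric]
    using nz by (simp add: field_simps flip: power_add)
  finally show "q * deriv A q = 4 * A q * (q * deriv theta3 q / theta3 q) +
           theta3 q ^ 8 * alpha q * (1 - alpha q)"
    unfolding dd A_eq[OF q] T_def P_def V_def .
qed

text \<open>This chain rule for q d/dq is the source of the factor \<open>l\<close> in the
  theorem.\<close>

lemma q_deriv_compose_power:
  assumes "(f has_field_derivative d) (at (q ^ l))" "l > 0"
  shows "q * deriv (\<lambda>z. f (z ^ l)) q = of_nat l * (q ^ l * d)"
proof -
  have "((\<lambda>z. f (z ^ l)) has_field_derivative d * (of_nat l * q ^ (l - 1))) (at q)"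
    by (rule DERIV_chain2[where f = f and g = "\<lambda>z. z ^ l", OF assms(1)])
       (auto intro!: derivative_eq_intros)
  hence "deriv (\<lambda>z. f (z ^ l)) q = d * (of_nat l * q ^ (l - 1))"
    by (rule DERIV_imp_deriv)
  moreover have "q ^ l = q * q ^ (l - 1)"
    using assms(2) by (cases l) auto
  ultimately show ?thesis by simp
qed

section \<open>Positivity on the real interval and choice of branches\<close>

lemma exponent_series_of_real: "Im (exponent_series e (of_real x)) = 0"
proof -
  have "cnj (exponent_series e (of_real x)) = exponent_series e (of_real x)"
    unfolding exponent_series_def infsum_cnj[symmetric] by simp
  thus ?thesis
    by (metis Reals_cnj_iff complex_is_Real_iff)
qed

lemma theta3_of_real_square:
  assumes "\<bar>x\<bar> < 1"
  obtains c where "c > 0" "theta3 (of_real x) ^ 2 = complex_of_real c"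
proof -
  have "theta3 (of_real x) = of_real (Re (theta3 (of_real x)))"
    by (simp add: complex_eq_iff theta3_eq_exponent_series exponent_series_of_real)
  moreover have "theta3 (of_real x) \<noteq> 0"
    using assms by (intro theta3_nonzero) simp
  ultimately show ?thesis
    by (intro that[of "Re (theta3 (of_real x)) ^ 2"])
       (metis of_real_0 zero_less_power2, metis of_real_power)
qed

lemma A_of_real_pos:
  assumes "0 < x" "x < 1"
  obtains c where "c > 0" "A (of_real x) = complex_of_real c"
proof -
  have x: "norm (complex_of_real x) < 1" "complex_of_real x \<noteq> 0"
    using assms by simp_all
  define a b where "a = Re (theta3 (of_real x))" and "b = Re (psi (of_real x))"
  have ab: "theta3 (of_real x) = of_real a" "psi (of_real x) = of_real b"
    by (simp_all add: a_def b_def complex_eq_iff theta3_eq_exponent_series psi_def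
        exponent_series_of_real)
  have "a \<noteq> 0"
    using theta3_nonzero[OF x(1)] ab by auto
  hence "a ^ 4 + x * b ^ 4 > 0"
    using assms by (intro add_pos_nonneg) auto
  thus ?thesis
    by (intro that[of "a ^ 4 + x * b ^ 4"]) (auto simp: A_eq[OF x] ab)
qed

text \<open>The quotient f / g is continuous on a connected set with values in {1, -1}, hence
  constant, and positivity at \<open>c\<close> makes it 1.\<close>

lemma sqrt_branch_unique:
  fixes f g :: "complex \<Rightarrow> complex"
  assumes "connected U" "continuous_on U f" "continuous_on U g"
    and sq: "\<And>z. z \<in> U \<Longrightarrow> f z ^ 2 = g z ^ 2" and nz: "\<And>z. z \<in> U \<Longrightarrow> g z \<noteq> 0"
    and "c \<in> U" "f c = of_real a" "g c = of_real b" "a > 0" "b > 0" and "z \<in> U"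
  shows "f z = g z"
proof -
  have "f z / g z \<in> {1, -1}" if "z \<in> U" for z
    using sq[OF that] nz[OF that] by (auto simp: power2_eq_iff)
  hence "(\<lambda>z. f z / g z) ` U \<subseteq> {1, -1}"
    by blast
  hence "finite ((\<lambda>z. f z / g z) ` U)"
    by (rule finite_subset) simp
  hence "(\<lambda>z. f z / g z) constant_on U"
    using assms by (intro continuous_finite_range_constant continuous_intros) auto
  hence "f z / g z = f c / g c"
    using \<open>c \<in> U\<close> \<open>z \<in> U\<close> unfolding constant_on_def by metis
  also have "f c / g c = 1"
  proof -
    have "a\<^sup>2 = b\<^sup>2"
      using sq[OF \<open>c \<in> U\<close>] assms(7,8) by (metis of_real_eq_iff of_real_power)
    hence "a = b"
      using assms by (simp add: power2_eq_iff)
    thus ?thesis using assms by simp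
  qed
  finally show ?thesis
    using nz[OF \<open>z \<in> U\<close>] by simp
qed

text \<open>The branches live on an arbitrary connected set that avoids the zeros of A(z) and A(z^l)
  and contains the interval (0, 1), where positivity normalizes them.\<close>

theorem theorem6p2:
  fixes l :: nat and U :: "complex set" and s r t u :: "complex \<Rightarrow> complex" and q :: complex
  assumes "l > 0"
    and "connected U"
    and "complex_of_real ` {0<..<1} \<subseteq> U"
    and "U \<subseteq> {z. 0 < norm z \<and> norm z < 1 \<and> A z \<noteq> 0 \<and> A (z ^ l) \<noteq> 0}"
    and "sqrt_branch_on U (\<lambda>z. A z ^ 3 * A (z ^ l) ^ 3) s"
    and "sqrt_branch_on U (\<lambda>z. (Z z * Z (z ^ l)) / (A z * A (z ^ l))) r"
    and "sqrt_branch_on U (\<lambda>z. Z z / Z (z ^ l)) t"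
    and "sqrt_branch_on U (\<lambda>z. Z (z ^ l) / Z z) u"
    and "q \<in> U"
  shows "- D_perp s l q =
    r q * (1 / (1 + alpha q) * t q * alpha q * (1 - alpha q)
           - of_nat l / (1 + alpha (q ^ l)) * u q * alpha (q ^ l) * (1 - alpha (q ^ l))
           - 4 * D l q)"
proof -
  have U: "norm z < 1" "z \<noteq> 0" "norm (z ^ l) < 1" "z ^ l \<noteq> 0" "A z \<noteq> 0" "A (z ^ l) \<noteq> 0"
    "theta3 z \<noteq> 0" "theta3 (z ^ l) \<noteq> 0"
    if "z \<in> U" for z
  proof -
    show "norm z < 1" "z \<noteq> 0" "z ^ l \<noteq> 0" "A z \<noteq> 0" "A (z ^ l) \<noteq> 0"
      using assms(4) that by auto
    show "norm (z ^ l) < 1"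
      using \<open>norm z < 1\<close> \<open>l > 0\<close> by (simp add: norm_power power_less_one_iff)
    show "theta3 z \<noteq> 0" "theta3 (z ^ l) \<noteq> 0"
      using \<open>norm z < 1\<close> \<open>norm (z ^ l) < 1\<close> by (simp_all add: theta3_nonzero)
  qed
  have sub: "U \<subseteq> ball 0 1" "(\<lambda>z. z ^ l) ` U \<subseteq> ball 0 1"
    using U by auto
  have cont3: "continuous_on U theta3" and cont3l: "continuous_on U (\<lambda>z. theta3 (z ^ l))"
    and contp: "continuous_on U psi" and contpl: "continuous_on U (\<lambda>z. psi (z ^ l))"
    using sub
    by (auto intro!: continuous_on_subset[OF continuous_on_theta3] continuous_on_subset[OF continuous_on_psi]
        continuous_on_compose2[OF continuous_on_theta3] continuous_on_compose2[OF continuous_on_psi]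
        continuous_intros)
  have "continuous_on U (\<lambda>z. theta3 z ^ 4 + z * psi z ^ 4)"
    by (intro continuous_intros cont3 contp)
  hence contA: "continuous_on U A"
    by (rule continuous_on_eq) (use U in \<open>simp add: A_eq\<close>)
  have "continuous_on U (\<lambda>z. theta3 (z ^ l) ^ 4 + z ^ l * psi (z ^ l) ^ 4)"
    by (intro continuous_intros cont3l contpl)
  hence contAl: "continuous_on U (\<lambda>z. A (z ^ l))"
    by (rule continuous_on_eq) (use U in \<open>simp add: A_eq\<close>)

  \<comment> \<open>A sample point of the real interval, at which the signs of all branches are
    compared.\<close>
  define c :: complex where "c = of_real (1 / 2)"
  have "c \<in> U"
    using assms(3) unfolding c_def by (intro subsetD[OF assms(3)] imageI) simp
  have half: "0 < (1 / 2 :: real) ^ l" "(1 / 2 :: real) ^ l < 1"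
    using \<open>l > 0\<close> by (simp_all add: power_less_one_iff)
  have cl: "c ^ l = of_real ((1 / 2) ^ l)"
    by (simp add: c_def)
  obtain a where a: "a > 0" "A c = complex_of_real a"
    using A_of_real_pos[of "1 / 2"] unfolding c_def by auto
  obtain al where al: "al > 0" "A (c ^ l) = complex_of_real al"
    using A_of_real_pos[OF half] unfolding cl by blast
  obtain b where b: "b > 0" "theta3 c ^ 2 = complex_of_real b"
    using theta3_of_real_square[of "1 / 2"] unfolding c_def by auto
  obtain bl where bl: "bl > 0" "theta3 (c ^ l) ^ 2 = complex_of_real bl"
    using theta3_of_real_square[of "(1 / 2) ^ l"] half unfolding cl by auto
  have pos: "\<exists>x>0. f c = complex_of_real x" if "sqrt_branch_on U g f" for f g
  proof -
    have "Im (f c) = 0" "Re (f c) > 0"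
      using that[unfolded sqrt_branch_on_def] by (auto simp: c_def dest!: spec[of _ "1 / 2"])
    thus ?thesis
      by (intro exI[of _ "Re (f c)"]) (simp add: complex_eq_iff)
  qed
  obtain sc rc tc uc where sc: "sc > 0" "s c = complex_of_real sc" "rc > 0" "r c = complex_of_real rc"
    "tc > 0" "t c = complex_of_real tc" "uc > 0" "u c = complex_of_real uc"
    using pos[OF assms(5)] pos[OF assms(6)] pos[OF assms(7)] pos[OF assms(8)] by blast
  note br = assms(5-8)[unfolded sqrt_branch_on_def]
  have Z2: "Z z = (theta3 z ^ 2) ^ 2" for z
    by (simp add: Z_def flip: power_mult)

  \<comment> \<open>Only the product of \<open>r\<close> and \<open>s\<close> is identified: its
    square is the square of an explicit function, whereas \<open>s\<close> by itself is a root of an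
    odd power.\<close>
  have rs: "r q * s q = A q * A (q ^ l) * (theta3 q ^ 2 * theta3 (q ^ l) ^ 2)"
  proof (rule sqrt_branch_unique[of U "\<lambda>z. r z * s z"
        "\<lambda>z. A z * A (z ^ l) * (theta3 z ^ 2 * theta3 (z ^ l) ^ 2)" c "rc * sc" "a * al * (b * bl)"])
    fix z assume z: "z \<in> U"
    have "(r z * s z)\<^sup>2 = (Z z * Z (z ^ l)) / (A z * A (z ^ l)) * (A z ^ 3 * A (z ^ l) ^ 3)"
      using br z by (simp add: power_mult_distrib)
    also have "\<dots> = (A z * A (z ^ l) * (theta3 z ^ 2 * theta3 (z ^ l) ^ 2))\<^sup>2"
      using U[OF z] unfolding Z2 by (simp add: field_simps eval_nat_numeral)
    finally show "(r z * s z)\<^sup>2 = (A z * A (z ^ l) * (theta3 z ^ 2 * theta3 (z ^ l) ^ 2))\<^sup>2" .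
  qed (use assms br U \<open>c \<in> U\<close> a al b bl sc in
        \<open>auto intro!: continuous_intros contA contAl cont3 cont3l\<close>)
  have t: "t q = theta3 q ^ 2 / theta3 (q ^ l) ^ 2"
    by (rule sqrt_branch_unique[of U t "\<lambda>z. theta3 z ^ 2 / theta3 (z ^ l) ^ 2" c tc "b / bl"])
       (use assms br U \<open>c \<in> U\<close> b bl sc in
        \<open>auto intro!: continuous_intros cont3 cont3l simp: Z2 power_divide\<close>)
  have u: "u q = theta3 (q ^ l) ^ 2 / theta3 q ^ 2"
    by (rule sqrt_branch_unique[of U u "\<lambda>z. theta3 (z ^ l) ^ 2 / theta3 z ^ 2" c uc "bl / b"])
       (use assms br U \<open>c \<in> U\<close> b bl sc in
        \<open>auto intro!: continuous_intros cont3 cont3l simp: Z2 power_divide\<close>)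

  note q = U[OF \<open>q \<in> U\<close>]
  define T Tl V Vl x y where "T = theta3 q" and "Tl = theta3 (q ^ l)"
    and "V = q * deriv theta3 q / theta3 q"
    and "Vl = q ^ l * deriv theta3 (q ^ l) / theta3 (q ^ l)"
    and "x = alpha q" and "y = alpha (q ^ l)"
  have nz: "T \<noteq> 0" "Tl \<noteq> 0"
    using q by (simp_all add: T_def Tl_def)
  have Aq: "A q = T ^ 4 * (1 + x)" and Al: "A (q ^ l) = Tl ^ 4 * (1 + y)"
    using A_eq_alpha q by (simp_all add: T_def Tl_def x_def y_def)
  have nzx: "1 + x \<noteq> 0" "1 + y \<noteq> 0"
    using q unfolding Aq Al by auto
  have "(s q)\<^sup>2 = A q ^ 3 * A (q ^ l) ^ 3"
    using br \<open>q \<in> U\<close> by simp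
  hence snz: "s q \<noteq> 0"
    using q by auto
  have dA: "q * deriv A q = 4 * A q * V + T ^ 8 * x * (1 - x)"
    using has_field_derivative_A(2)[of q] q by (simp add: V_def T_def x_def)
  have dAl: "q * deriv (\<lambda>z. A (z ^ l)) q = of_nat l * (4 * A (q ^ l) * Vl + Tl ^ 8 * y * (1 - y))"
    using q_deriv_compose_power[OF has_field_derivative_A(1)[of "q ^ l"] \<open>l > 0\<close>]
      has_field_derivative_A(2)[of "q ^ l"] q
    by (simp add: Vl_def Tl_def y_def)
  have dT: "q * deriv theta3 q = T * V"
    using q by (simp add: T_def V_def)
  have dTl: "q * deriv (\<lambda>z. theta3 (z ^ l)) q = of_nat l * (Tl * Vl)"
    using q_deriv_compose_power[OF has_field_derivative_theta3[of "q ^ l"] \<open>l > 0\<close>] q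
    by (simp add: Tl_def Vl_def)
  \<comment> \<open>Up to the denominator, the determinant is the difference of the logarithmic
    derivatives of theta3(q^l) and theta3(q) with respect to q d/dq.\<close>
  have Dl: "D l q = (of_nat l * Vl - V) / (T\<^sup>2 * Tl\<^sup>2)"
    unfolding D_def det_2 vector_2 dT dTl T_def[symmetric] Tl_def[symmetric]
    using nz by (simp add: field_simps eval_nat_numeral)
  have r: "r q = A q * A (q ^ l) * (T\<^sup>2 * Tl\<^sup>2) / s q"
    using rs snz by (simp add: T_def Tl_def field_simps)
  have "- D_perp s l q = (A (q ^ l) * (4 * A q * V + T ^ 8 * x * (1 - x)) -
      A q * (of_nat l * (4 * A (q ^ l) * Vl + Tl ^ 8 * y * (1 - y)))) / s q"
    unfolding D_perp_def det_2 vector_2 dA dAl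
    by (simp only: mult_1 times_divide_eq_left minus_divide_left minus_diff_eq mult.commute)
  \<comment> \<open>The relation A = theta3^4 (1 + \<alpha>) at q and at q^l lets the common factor
    \<open>A q * A (q ^ l)\<close> be pulled out, which lowers the eighth powers to fourth powers
    over \<open>1 + x\<close> and \<open>1 + y\<close>.\<close>
  also have "\<dots> = A q * A (q ^ l) * (T ^ 4 * x * (1 - x) / (1 + x)
      - of_nat l * (Tl ^ 4 * y * (1 - y) / (1 + y)) - 4 * (of_nat l * Vl - V)) / s q"
  proof -
    have "A (q ^ l) * (T ^ 8 * x * (1 - x)) = A q * A (q ^ l) * (T ^ 4 * x * (1 - x) / (1 + x))"
      unfolding Aq using nzx by (simp add: flip: power_add)
    moreover have "A q * (Tl ^ 8 * y * (1 - y)) =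
        A q * A (q ^ l) * (Tl ^ 4 * y * (1 - y) / (1 + y))"
      unfolding Al using nzx by (simp add: flip: power_add)
    \<comment> \<open>Stated for arbitrary numbers so that the quotients stay opaque in the
      polynomial calculation.\<close>
    moreover have "b * (4 * a * V + m) - a * (n * (4 * b * Vl + k)) =
        a * b * (m' - n * k' - 4 * (n * Vl - V))"
      if "b * m = a * b * m'" "a * k = a * b * k'" for a b m m' n k k' :: complex
    proof -
      have "b * (4 * a * V + m) - a * (n * (4 * b * Vl + k)) =
          4 * a * b * V + b * m - 4 * n * a * b * Vl - n * (a * k)"
        by (simp add: algebra_simps)
      also have "\<dots> = a * b * (m' - n * k' - 4 * (n * Vl - V))"
        unfolding that by (simp add: algebra_simps)
      finally show ?thesis .
    qed
    ultimately show ?thesis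
      by metis
  qed
  \<comment> \<open>The factor of theta squares in \<open>r q\<close> becomes a fourth power of
    \<open>T\<close> or \<open>Tl\<close> when multiplied by \<open>t q\<close> or
    \<open>u q\<close>, and cancels the denominator of \<open>D l q\<close>.\<close>
  also have "\<dots> = r q * (1 / (1 + x) * t q * x * (1 - x)
           - of_nat l / (1 + y) * u q * y * (1 - y) - 4 * D l q)"
  proof -
    have "T\<^sup>2 * Tl\<^sup>2 * (1 / (1 + x) * t q * x * (1 - x)) = T ^ 4 * x * (1 - x) / (1 + x)"
      unfolding t T_def[symmetric] Tl_def[symmetric] using nz
      by (simp add: power2_eq_square power4_eq_xxxx)
    moreover have "T\<^sup>2 * Tl\<^sup>2 * (of_nat l / (1 + y) * u q * y * (1 - y)) =
        of_nat l * (Tl ^ 4 * y * (1 - y) / (1 + y))"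
      unfolding u T_def[symmetric] Tl_def[symmetric] using nz
      by (simp add: power2_eq_square power4_eq_xxxx)
    moreover have "T\<^sup>2 * Tl\<^sup>2 * (4 * D l q) = 4 * (of_nat l * Vl - V)"
      unfolding Dl using nz by simp
    ultimately have "T\<^sup>2 * Tl\<^sup>2 * (1 / (1 + x) * t q * x * (1 - x)
           - of_nat l / (1 + y) * u q * y * (1 - y) - 4 * D l q) =
        T ^ 4 * x * (1 - x) / (1 + x) - of_nat l * (Tl ^ 4 * y * (1 - y) / (1 + y))
        - 4 * (of_nat l * Vl - V)"
      by (simp only: right_diff_distrib)
    thus ?thesis
      unfolding r by (metis (no_types) mult.assoc times_divide_eq_left)
  qed
  finally show ?thesis
    unfolding x_def y_def .
qed

end
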